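(* Let $T$ be an algebraic torus over an algebraically closed field $k$, with character lattice $\Lambda$, acting on $\mathbb{P}(V)$, $V=k^n$, by $t(x_1:\ldots:x_n)=(\chi_1(t)x_1:\ldots:\chi_n(t)x_n)$ with $\chi_1,\ldots,\chi_n\in\Lambda$. Then the orbit closure $X=\overline{T(1:\ldots:1)}\subset\mathbb{P}(V)$ satisfies the weak separation property (WSP) if and only if there is no more than one of the characters $\chi_i$ (counted with index $i$) in the interior of any face of the convex hull $\mathrm{conv}\{\chi_1,\ldots,\chi_n\}$ (in particular, $\chi_i\neq\chi_j$ for $i\neq j$).
   Context: A subset $Y\subset\mathbb{P}(V)$ has the weak separation property (WSP) if for any pair $D\neq D'$ of hyperplanes in $\mathbb{P}(V)$ one has $D\cap Y\neq D'\cap Y$ as sets. Closures are Zariski closures. The convex hull is taken in $\Lambda\otimes_{\mathbb{Z}}\mathbb{Q}$; its faces include the vertices and the whole polytope, and the interior of a face means its relative interior (the interior of a vertex is the vertex itself). *)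

theory Defs
  imports
    "HOL-Library.Poly_Mapping"
    "HOL-Computational_Algebra.Polynomial"
    "Jordan_Normal_Form.Matrix"
begin

text \<open>Vectors of length \<open>n\<close> are elements of \<^term>\<open>carrier_vec n\<close>, indexed from 0. Points of the projective
  space of \<open>V = k\<^sup>n\<close> are the lines through the origin of \<open>V\<close>, so \<open>proj_pt x\<close> is the point with
  homogeneous coordinates \<open>x\<close>.\<close>

definition proj_pt :: "'k::field vec \<Rightarrow> 'k vec set" where
  "proj_pt x = range (\<lambda>c. c \<cdot>\<^sub>v x)"

definition proj_space :: "nat \<Rightarrow> 'k::field vec set set" where
  "proj_space n = {proj_pt x | x. x \<in> carrier_vec n \<and> x \<noteq> 0\<^sub>v n}"

definition is_hyperplane :: "nat \<Rightarrow> 'k::field vec set set \<Rightarrow> bool" where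
  "is_hyperplane n D \<longleftrightarrow> (\<exists>a \<in> carrier_vec n. a \<noteq> 0\<^sub>v n \<and>
     D = {proj_pt x | x. x \<in> carrier_vec n \<and> x \<noteq> 0\<^sub>v n \<and> a \<bullet> x = 0})"

definition weak_separation :: "nat \<Rightarrow> 'k::field vec set set \<Rightarrow> bool" where
  "weak_separation n Y \<longleftrightarrow>
     (\<forall>D D'. is_hyperplane n D \<longrightarrow> is_hyperplane n D' \<longrightarrow> D \<noteq> D' \<longrightarrow> D \<inter> Y \<noteq> D' \<inter> Y)"

text \<open>A polynomial is a finitely supported map from monomials (exponent vectors, themselves finitely
  supported maps from variable indices to exponents) to coefficients.\<close>

type_synonym 'k mpoly = "(nat \<Rightarrow>\<^sub>0 nat) \<Rightarrow>\<^sub>0 'k"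

definition eval_mpoly :: "'k::field mpoly \<Rightarrow> 'k vec \<Rightarrow> 'k" where
  "eval_mpoly f x = (\<Sum>m \<in> Poly_Mapping.keys f. Poly_Mapping.lookup f m *
     (\<Prod>i \<in> Poly_Mapping.keys m. (x $ i) ^ Poly_Mapping.lookup m i))"

definition homogeneous :: "nat \<Rightarrow> nat \<Rightarrow> 'k::field mpoly \<Rightarrow> bool" where
  "homogeneous n d f \<longleftrightarrow> (\<forall>m \<in> Poly_Mapping.keys f. Poly_Mapping.keys m \<subseteq> {..<n} \<and>
     (\<Sum>i \<in> Poly_Mapping.keys m. Poly_Mapping.lookup m i) = d)"

definition zariski_closed :: "nat \<Rightarrow> 'k::field vec set set \<Rightarrow> bool" where
  "zariski_closed n Z \<longleftrightarrow> (\<exists>S. (\<forall>f \<in> S. \<exists>d. homogeneous n d f) \<and>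
     Z = {proj_pt x | x. x \<in> carrier_vec n \<and> x \<noteq> 0\<^sub>v n \<and> (\<forall>f \<in> S. eval_mpoly f x = 0)})"

definition zariski_closure :: "nat \<Rightarrow> 'k::field vec set set \<Rightarrow> 'k vec set set" where
  "zariski_closure n Y = zariski_closed n hull Y"

text \<open>The torus of rank \<open>r\<close> is the group \<open>(k\<^sup>*)\<^sup>r\<close>; its character lattice is the lattice of integer vectors
  of length \<open>r\<close>, where \<open>m\<close> stands for the character \<open>t \<mapsto> t\<^sub>0\<^bsup>m\<^sub>0\<^esup> \<cdots> t\<^bsub>r-1\<^esub>\<^bsup>m\<^bsub>r-1\<^esub>\<^esup>\<close>.\<close>

definition torus :: "nat \<Rightarrow> 'k::field vec set" where
  "torus r = {t \<in> carrier_vec r. \<forall>j<r. t $ j \<noteq> 0}"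

definition character :: "int vec \<Rightarrow> 'k::field vec \<Rightarrow> 'k" where
  "character m t = (\<Prod>j<dim_vec m. (t $ j) powi (m $ j))"

definition torus_act :: "nat \<Rightarrow> (nat \<Rightarrow> int vec) \<Rightarrow> 'k::field vec \<Rightarrow> 'k vec set \<Rightarrow> 'k vec set" where
  "torus_act n chi t p = (\<lambda>x. vec n (\<lambda>i. character (chi i) t * x $ i)) ` p"

lemma torus_act_proj_pt:
  assumes "x \<in> carrier_vec n"
  shows "torus_act n chi t (proj_pt x) = proj_pt (vec n (\<lambda>i. character (chi i) t * x $ i))"
proof -
  have "vec n (\<lambda>i. character (chi i) t * (c \<cdot>\<^sub>v x) $ i)
      = c \<cdot>\<^sub>v vec n (\<lambda>i. character (chi i) t * x $ i)" for c
    using assms by (intro eq_vecI) (auto simp: algebra_simps)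
  then show ?thesis
    unfolding torus_act_def proj_pt_def by (simp add: image_image)
qed

definition orbit_closure :: "nat \<Rightarrow> nat \<Rightarrow> (nat \<Rightarrow> int vec) \<Rightarrow> 'k::field vec set set" where
  "orbit_closure r n chi =
     zariski_closure n {torus_act n chi t (proj_pt (vec n (\<lambda>_. 1))) | t. t \<in> torus r}"

text \<open>Convex geometry over the rationals, following the library's definitions of \<open>convex\<close>, \<open>affine\<close> and
  \<open>rel_interior\<close>, which are only available over the reals.\<close>

definition rat_convex :: "rat vec set \<Rightarrow> bool" where
  "rat_convex C \<longleftrightarrow>
     (\<forall>x\<in>C. \<forall>y\<in>C. \<forall>u\<ge>0. \<forall>v\<ge>0. u + v = 1 \<longrightarrow> u \<cdot>\<^sub>v x + v \<cdot>\<^sub>v y \<in> C)"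

definition rat_affine :: "rat vec set \<Rightarrow> bool" where
  "rat_affine C \<longleftrightarrow> (\<forall>x\<in>C. \<forall>y\<in>C. \<forall>u v. u + v = 1 \<longrightarrow> u \<cdot>\<^sub>v x + v \<cdot>\<^sub>v y \<in> C)"

text \<open>A point is relatively interior if some sup-norm ball around it in the affine hull stays in the set.\<close>

definition rat_rel_interior :: "rat vec set \<Rightarrow> rat vec set" where
  "rat_rel_interior F = {x \<in> F. \<exists>e>0. \<forall>y \<in> rat_affine hull F.
     (\<forall>j<dim_vec x. \<bar>y $ j - x $ j\<bar> < e) \<longrightarrow> y \<in> F}"

text \<open>Faces are cut out by supporting functionals; the zero functional gives the whole polytope (and
  possibly the empty face).\<close>

definition is_face :: "nat \<Rightarrow> rat vec set \<Rightarrow> rat vec set \<Rightarrow> bool" where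
  "is_face r P F \<longleftrightarrow> (\<exists>u \<in> carrier_vec r. \<exists>c.
     (\<forall>p\<in>P. u \<bullet> p \<le> c) \<and> F = {p \<in> P. u \<bullet> p = c})"

definition rat_point :: "int vec \<Rightarrow> rat vec" where
  "rat_point m = map_vec of_int m"

definition weight_polytope :: "nat \<Rightarrow> (nat \<Rightarrow> int vec) \<Rightarrow> rat vec set" where
  "weight_polytope n chi = rat_convex hull (rat_point ` chi ` {..<n})"

end

theory Submission
  imports Defs
begin

text \<open>A hyperplane restricts to the orbit as a Laurent polynomial \<open>f\<close> whose exponents are among the
  characters \<open>\<chi>\<^sub>i\<close>, and the limits of the orbit along one-parameter subgroups show that its section of
  \<open>X\<close> determines the zeros in the torus of the part of \<open>f\<close> on each face of the polytope.

  If \<open>\<chi>\<^sub>i\<close> and \<open>\<chi>\<^sub>j\<close> lie in the interior of the same face, then on \<open>X\<close> a power of \<open>x\<^sub>i\<close> equals a monomial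
  involving \<open>x\<^sub>j\<close> and vice versa, so \<open>x\<^sub>i = 0\<close> and \<open>x\<^sub>j = 0\<close> cut out the same subset of \<open>X\<close>.

  Conversely, let \<open>f\<close> and \<open>g\<close> have the same zeros on all faces. Inclusions between zero sets pass to
  initial forms, and a Laurent polynomial has zeros in the torus unless it is a monomial. By
  induction on the faces of the polytope this gives \<open>f\<close> and \<open>g\<close> the same Newton polytope. By induction
  on the faces of the latter, \<open>f\<close> and \<open>g\<close> are proportional on it: on the boundary by connectedness (for
  a segment, by an elementary argument on trinomials), and the remaining difference
  \<open>f - c g\<close> has at most one term, hence is zero if \<open>f\<close> has zeros.\<close>

section \<open>Polynomials over algebraically closed fields\<close>

text \<open>Zeros in the torus forget monomial factors and multiplicities: \<open>f\<close> and
  \<open>x f\<close> share their zeros, and so do \<open>(x - 1)^2 (x - c)\<close> and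
  \<open>(x - 1) (x - c)^2\<close>. The first ambiguity disappears because zeros are compared on the
  faces of the polytope of all characters, where a restriction that vanishes identically is told
  apart from a monomial. The second is excluded by the hypothesis on interiors, since the last pair
  needs two characters inside one segment. That hypothesis enters the algebra only as antisymmetry
  of the preorder "every face containing one character contains the other"; Farkas' lemma links this
  preorder to relative interiors. No topology is available on the field, so limits are polynomial
  families in a parameter, specialized at 0. A zero of an initial form does not come with explicit
  nearby zeros of the polynomial, so the passage to the limit is made on a divisibility identity
  instead of on points.\<close>

lemma infinite_alg_closed: "infinite (UNIV :: 'k::alg_closed_field set)"
proof
  assume fin: "finite (UNIV :: 'k set)"
  define p :: "'k poly" where "p = (\<Prod>a\<in>UNIV. [:-a, 1:]) + 1"
  have "degree (\<Prod>a\<in>(UNIV::'k set). [:-a, 1:]) = card (UNIV :: 'k set)"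
    by (subst degree_prod_eq_sum_degree) auto
  moreover have "card (UNIV :: 'k set) > 0" using fin by (simp add: finite_UNIV_card_ge_0)
  ultimately have "degree p > 0" unfolding p_def by (subst degree_add_eq_left) auto
  then obtain x where "poly p x = 0" using alg_closed_imp_poly_has_root by blast
  moreover have "poly (\<Prod>a\<in>(UNIV::'k set). [:-a, 1:]) x = 0"
    using fin by (auto simp: poly_prod)
  ultimately show False by (simp add: p_def)
qed

lemma poly_eq_0_if_zero_off_0:
  fixes p :: "'k::alg_closed_field poly"
  assumes "finite A" "\<And>x. x \<notin> A \<Longrightarrow> poly p x = 0"
  shows "p = 0"
proof (rule ccontr)
  assume "p \<noteq> 0"
  then have "finite {x. poly p x = 0}" by (rule poly_roots_finite)
  moreover have "UNIV = A \<union> {x. poly p x = 0}" using assms(2) by auto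
  ultimately show False using infinite_alg_closed[where 'k='k] assms(1) by (metis finite_Un)
qed

lemma prod_mset_linear_dvd_power:
  fixes h :: "'k::field poly"
  assumes "\<And>x. x \<in># A \<Longrightarrow> poly h x = 0"
  shows "(\<Prod>x\<in>#A. [:-x, 1:]) dvd h ^ size A"
  using assms
proof (induction A)
  case (add x A)
  have "[:-x, 1:] dvd h" using add.prems by (simp add: poly_eq_0_iff_dvd)
  then have "[:-x,1:] * (\<Prod>x\<in>#A. [:-x, 1:]) dvd h * h ^ size A"
    by (intro mult_dvd_mono add.IH) (use add.prems in auto)
  then show ?case by simp
qed auto

text \<open>A one-variable Nullstellensatz with explicit exponent: \<open>N\<close> depends on the
  degree alone, so the same power serves all specializations of a parameter at once.\<close>

lemma dvd_power_if_roots: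
  fixes p h :: "'k::alg_closed_field poly"
  assumes "p \<noteq> 0" "degree p \<le> N" "\<And>x. poly p x = 0 \<Longrightarrow> poly h x = 0"
  shows "p dvd h ^ N"
proof -
  obtain A where A: "size A = degree p" "p = Polynomial.smult (lead_coeff p) (\<Prod>x\<in>#A. [:-x, 1:])"
    using alg_closed_imp_factorization[OF assms(1)] by blast
  have "poly p x = 0" if "x \<in># A" for x
    by (subst A(2)) (use that in \<open>auto simp: poly_prod_mset\<close>)
  then have "(\<Prod>x\<in>#A. [:-x, 1:]) dvd h ^ size A"
    by (intro prod_mset_linear_dvd_power assms(3))
  then have "p dvd h ^ size A"
    using assms(1) by (subst A(2)) (intro smult_dvd, auto)
  moreover have "h ^ size A dvd h ^ N" using A(1) assms(2) by (intro le_imp_power_dvd) simp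
  ultimately show ?thesis by (rule dvd_trans)
qed

text \<open>The coefficients are polynomials in a parameter, which is set to \<open>e\<close>.\<close>

definition specialize :: "'k::field \<Rightarrow> 'k poly poly \<Rightarrow> 'k poly" where
  "specialize e F = map_poly (\<lambda>c. poly c e) F"

lemma coeff_specialize [simp]: "coeff (specialize e F) i = poly (coeff F i) e"
  by (simp add: specialize_def coeff_map_poly)

lemma specialize_0 [simp]: "specialize e 0 = 0"
  and specialize_add: "specialize e (F + G) = specialize e F + specialize e G"
  and specialize_smult: "specialize e (Polynomial.smult c F) = Polynomial.smult (poly c e) (specialize e F)"
  and specialize_monom: "specialize e (monom c i) = monom (poly c e) i"
  and specialize_pCons: "specialize e (pCons c F) = pCons (poly c e) (specialize e F)"
  by (auto intro!: poly_eqI simp: coeff_pCons split: nat.splits)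

lemma specialize_mult: "specialize e (F * G) = specialize e F * specialize e G"
  by (induction F) (auto simp: specialize_add specialize_smult specialize_pCons)

lemma specialize_power: "specialize e (F ^ i) = specialize e F ^ i"
  by (induction i) (auto simp: specialize_mult one_pCons specialize_pCons)

lemma specialize_sum: "specialize e (\<Sum>i\<in>A. F i) = (\<Sum>i\<in>A. specialize e (F i))"
  by (induction A rule: infinite_finite_induct) (auto simp: specialize_add)

lemma degree_specialize_le: "degree (specialize e F) \<le> degree F"
  by (rule degree_le) (auto simp: coeff_eq_0)

lemma const_dvd_if_specialize_0:
  assumes "specialize 0 Q = 0"
  obtains Q' where "Q = Polynomial.smult [:0, 1:] Q'"
proof -
  have "[:[:0,1:]:] dvd Q"
    unfolding const_poly_dvd_iff
  proof
    fix i
    have "poly (coeff Q i) 0 = 0" using arg_cong[OF assms, of "\<lambda>p. coeff p i"] by simp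
    then show "[:0, 1:] dvd coeff Q i" using poly_eq_0_iff_dvd[of "coeff Q i" 0] by simp
  qed
  then show ?thesis using that by (auto elim!: dvdE)
qed

text \<open>The parameter \<open>[:0, 1:]\<close> is prime and does not divide \<open>F\<close>, so
  it divides \<open>Q\<close> whenever it divides \<open>c\<close>; each cancellation lowers the
  degree of \<open>c\<close>.\<close>

lemma cancel_parameter:
  fixes F Q W :: "'k::field poly poly"
  assumes "F * Q = Polynomial.smult c W" "c \<noteq> 0" "specialize 0 F \<noteq> 0"
  shows "\<exists>c' Q'. poly c' 0 \<noteq> 0 \<and> F * Q' = Polynomial.smult c' W"
  using assms(1,2)
proof (induction "degree c" arbitrary: c Q rule: less_induct)
  case less
  show ?case
  proof (cases "poly c 0 = 0")
    case True
    then have "[:0,1:] dvd c" using poly_eq_0_iff_dvd[of c 0] by simp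
    then obtain d where d: "c = [:0,1:] * d" by (elim dvdE)
    with less have "d \<noteq> 0" by auto
    with d have deg: "degree d < degree c" by simp
    have "specialize 0 F * specialize 0 Q = 0"
      using arg_cong[OF less.prems(1), of "specialize 0"] True by (simp add: specialize_mult specialize_smult)
    then have "specialize 0 Q = 0" using assms(3) by simp
    then obtain Q' where Q': "Q = Polynomial.smult [:0,1:] Q'" by (rule const_dvd_if_specialize_0)
    have "Polynomial.smult [:0,1:] (F * Q') = Polynomial.smult [:0,1:] (Polynomial.smult d W)"
      using less.prems(1) by (simp add: Q' d)
    then have "Polynomial.smult [:0,1:] (F * Q' - Polynomial.smult d W) = 0" by (simp add: smult_diff_right)
    then have "F * Q' = Polynomial.smult d W" by (subst (asm) smult_eq_0_iff) simp
    from less.hyps[OF deg this \<open>d \<noteq> 0\<close>] show ?thesis .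
  next
    case False
    then show ?thesis using less.prems(1) by blast
  qed
qed

text \<open>If the zero set of \<open>F\<close> lies in that of \<open>H\<close> for all nonzero parameters, then \<open>F\<close> divides a
  power of \<open>\<sigma> H\<close> up to a factor depending on the parameter only, and powers of the parameter can be
  cancelled from such an identity because \<open>F\<close> does not vanish at parameter 0.\<close>

lemma zero_inclusion_specializes:
  fixes F H :: "'k::alg_closed_field poly poly"
  assumes nz: "specialize 0 F \<noteq> 0"
    and sub: "\<And>e s. e \<noteq> 0 \<Longrightarrow> s \<noteq> 0 \<Longrightarrow> poly (specialize e F) s = 0 \<Longrightarrow> poly (specialize e H) s = 0"
    and zero: "poly (specialize 0 F) 1 = 0"
  shows "poly (specialize 0 H) 1 = 0"
proof -
  \<comment> \<open>The inclusion of zeros is assumed only for \<open>s \<noteq> 0\<close>; the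
    factor \<open>monom 1 1\<close> makes \<open>W\<close> vanish at a root \<open>s = 0\<close> as
    well.\<close>
  define W where "W = (monom 1 1 * H) ^ degree F"
  define c where "c = coeff F (degree F) ^ (Suc (degree W) - degree F)"
  have F: "F \<noteq> 0" using nz by auto
  then have c: "c \<noteq> 0" by (simp add: c_def)
  obtain Q R where QR: "pseudo_divmod W F = (Q, R)" by fastforce
  have eq: "Polynomial.smult c W = F * Q + R" unfolding c_def by (rule pseudo_divmod(1)[OF F QR])
  have deg: "R = 0 \<or> degree R < degree F" by (rule pseudo_divmod(2)[OF F QR])
  have W: "poly (specialize e W) s = (s * poly (specialize e H) s) ^ degree F" for e s
    by (simp add: W_def specialize_power specialize_mult specialize_monom poly_monom poly_power)
  \<comment> \<open>For all but finitely many parameters \<open>F\<close> keeps its degree; its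
    specialization then divides that of \<open>W\<close>, so the remainder, being of smaller degree,
    vanishes.\<close>
  have R0: "specialize e R = 0" if e: "e \<noteq> 0" "poly (lead_coeff F) e \<noteq> 0" for e
  proof -
    have d: "degree (specialize e F) = degree F"
      using e degree_specialize_le[of e F] le_degree[of "specialize e F" "degree F"] by simp
    have "specialize e F \<noteq> 0" using e(2) by (metis coeff_0 coeff_specialize)
    moreover have "poly (monom 1 1 * specialize e H) s = 0" if "poly (specialize e F) s = 0" for s
      using sub[OF e(1) _ that] by (cases "s = 0") (auto simp: poly_monom)
    ultimately have "specialize e F dvd (monom 1 1 * specialize e H) ^ degree F"
      using d by (intro dvd_power_if_roots) auto
    then have "specialize e F dvd specialize e W"
      by (simp add: W_def specialize_power specialize_mult specialize_monom)
    moreover have "Polynomial.smult (poly c e) (specialize e W) = specialize e F * specialize e Q + specialize e R"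
      using arg_cong[OF eq, of "specialize e"] by (simp add: specialize_add specialize_mult specialize_smult)
    ultimately have "specialize e F dvd specialize e F * specialize e Q + specialize e R"
      by (metis dvd_smult)
    then have "specialize e F dvd specialize e R" by (simp add: dvd_add_right_iff)
    moreover have "specialize e R = 0 \<or> degree (specialize e R) < degree (specialize e F)"
      using deg d degree_specialize_le[of e R] by auto
    ultimately show ?thesis using dvd_imp_degree_le[of "specialize e F" "specialize e R"] by linarith
  qed
  have "coeff R i = 0" for i
  proof (rule poly_eq_0_if_zero_off_0)
    show "finite ({0} \<union> {e. poly (lead_coeff F) e = 0})"
      using F by (simp add: poly_roots_finite)
    show "poly (coeff R i) e = 0" if "e \<notin> {0} \<union> {e. poly (lead_coeff F) e = 0}" for e
    proof -
      have "specialize e R = 0" using that by (intro R0) auto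
      then show ?thesis by (metis coeff_0 coeff_specialize)
    qed
  qed
  then have "R = 0" by (intro poly_eqI) simp
  then have "F * Q = Polynomial.smult c W" using eq[symmetric] by (simp only: add_0_right)
  then have "\<exists>c' Q'. poly c' 0 \<noteq> 0 \<and> F * Q' = Polynomial.smult c' W"
    using c nz by (rule cancel_parameter)
  then obtain c' Q' where c': "poly c' 0 \<noteq> 0" "F * Q' = Polynomial.smult c' W" by blast
  have "poly (specialize 0 F) 1 * poly (specialize 0 Q') 1 = poly c' 0 * poly (specialize 0 W) 1"
  proof -
    have "poly (specialize 0 (F * Q')) 1 = poly (specialize 0 (Polynomial.smult c' W)) 1"
      by (simp only: c'(2))
    then show ?thesis by (simp only: specialize_mult specialize_smult poly_mult poly_smult)
  qed
  then have "poly c' 0 * poly (specialize 0 W) 1 = 0" by (simp only: zero mult_zero_left)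
  then have "poly (specialize 0 W) 1 = 0" using c'(1) by (simp only: mult_eq_0_iff simp_thms)
  from trans[OF W[symmetric] this] have "(1 * poly (specialize 0 H) 1) ^ degree F = 0" .
  then have "1 * poly (specialize 0 H) 1 = 0" using power_not_zero by blast
  then show ?thesis by (simp only: mult_1)
qed

section \<open>Trinomials in one variable\<close>

lemma trinomial_poly:
  fixes A B C :: "'k::field"
  assumes "0 < p" "p < q" "C \<noteq> 0"
  obtains f where "\<And>s. poly f s = A + B * s ^ p + C * s ^ q" "degree f = q" "lead_coeff f = C"
proof -
  define f where "f = [:A:] + monom B p + monom C q"
  have cq: "coeff f q = C" using assms by (auto simp: f_def coeff_pCons split: nat.splits)
  have "degree f \<le> q"
    unfolding f_def by (intro degree_add_le) (use assms in \<open>auto intro: degree_monom_le le_trans\<close>)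
  then have "degree f = q" using cq assms(3) by (metis antisym le_degree)
  moreover have "poly f s = A + B * s ^ p + C * s ^ q" for s by (simp add: f_def poly_monom)
  ultimately show ?thesis using cq that by blast
qed

text \<open>A trinomial without roots other than \<open>z\<close> splits as
  \<open>C * (s - z) ^ q\<close>; comparing constant terms gives the ratio of its end
  coefficients.\<close>

lemma trinomial_roots_determine_ratio_coprime:
  fixes A B C A' B' C' :: "'k::alg_closed_field"
  assumes pq: "0 < p" "p < q" and nz: "A \<noteq> 0" "C \<noteq> 0" "A' \<noteq> 0" "C' \<noteq> 0"
    and uniq: "\<And>s. A + B * s ^ p + C * s ^ q = 0 \<Longrightarrow> s = z"
      "\<And>s. A' + B' * s ^ p + C' * s ^ q = 0 \<Longrightarrow> s = z"
  shows "A * C' = A' * C"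
proof -
  have key: "A = (- z) ^ q * C"
    if "A \<noteq> 0" "C \<noteq> 0" "\<And>s. A + B * s ^ p + C * s ^ q = 0 \<Longrightarrow> s = z" for A B C :: 'k
  proof -
    obtain f where ev: "\<And>s. poly f s = A + B * s ^ p + C * s ^ q"
      and deg: "degree f = q" and cq: "lead_coeff f = C"
      using trinomial_poly[OF pq \<open>C \<noteq> 0\<close>] by blast
    have "f \<noteq> 0" using pq deg by auto
    then obtain M where M: "size M = degree f" "f = Polynomial.smult (lead_coeff f) (\<Prod>x\<in>#M. [:-x, 1:])"
      using alg_closed_imp_factorization by blast
    have "x = z" if "x \<in># M" for x
    proof -
      have "poly f x = 0" by (subst M(2)) (use that in \<open>auto simp: poly_prod_mset\<close>)
      then show ?thesis using that ev \<open>\<And>s. A + B * s ^ p + C * s ^ q = 0 \<Longrightarrow> s = z\<close> by simp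
    qed
    then have "(\<Prod>x\<in>#M. [:-x, 1:]) = (\<Prod>x\<in>#M. [:-z, 1:])"
      by (intro arg_cong[where f = prod_mset] image_mset_cong) simp
    also have "\<dots> = [:-z, 1:] ^ q" using M(1) deg by (simp add: image_mset_const_eq)
    finally have "f = Polynomial.smult C ([:-z, 1:] ^ q)" using M(2) cq deg by simp
    then have "poly f 0 = (- z) ^ q * C" by (simp add: poly_power)
    then show ?thesis using ev[of 0] pq by (simp add: power_0_left)
  qed
  have "A = (- z) ^ q * C" by (rule key[OF nz(1,2) uniq(1)])
  moreover have "A' = (- z) ^ q * C'" by (rule key[OF nz(3,4) uniq(2)])
  ultimately show ?thesis by (simp add: algebra_simps)
qed

text \<open>If the ratios \<open>A : A'\<close> and \<open>C : C'\<close> differ, eliminating either end term shows that \<open>s ^ P\<close> and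
  \<open>s ^ (Q - P)\<close> are the same for all common roots \<open>s\<close>; hence after a substitution there is only
  one root, and then both trinomials are multiples of a power of a linear polynomial.\<close>

lemma trinomial_roots_determine_ratio:
  fixes A B C A' B' C' :: "'k::alg_closed_field"
  assumes PQ: "0 < P" "P < Q" and nz: "A \<noteq> 0" "C \<noteq> 0" "A' \<noteq> 0" "C' \<noteq> 0"
    and eq: "\<And>s. s \<noteq> 0 \<Longrightarrow> A + B * s ^ P + C * s ^ Q = 0 \<longleftrightarrow> A' + B' * s ^ P + C' * s ^ Q = 0"
  shows "A * C' = A' * C"
proof (rule ccontr)
  assume ne: "A * C' \<noteq> A' * C"
  define g where "g = gcd P Q"
  have g: "g > 0" using PQ by (simp add: g_def)
  obtain p q where pq: "P = g * p" "Q = g * q" "coprime p q"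
    using PQ by (metis g_def gcd_coprime_exists gcd_eq_0_iff mult.commute not_gr0)
  have pq': "0 < p" "p < q" using PQ pq g by auto
  \<comment> \<open>Every element is a \<open>g\<close>-th power, so the common factor of the
    exponents can be substituted away.\<close>
  have R: "A + B * s ^ p + C * s ^ q = 0 \<longleftrightarrow> A' + B' * s ^ p + C' * s ^ q = 0" if "s \<noteq> 0" for s
  proof -
    obtain y where y: "y ^ g = s" using nth_root_exists[OF g] by blast
    then have "y \<noteq> 0" using that g by auto
    then show ?thesis using eq[of y] y by (simp add: pq power_mult)
  qed
  have same: "s ^ p = t ^ p \<and> s ^ (q - p) = t ^ (q - p)"
    if s: "A + B * s ^ p + C * s ^ q = 0" and t: "A + B * t ^ p + C * t ^ q = 0" for s t
  proof -
    have s0: "x \<noteq> 0" if "A + B * x ^ p + C * x ^ q = 0" for x using that nz pq' by (cases "x = 0") (simp_all add: power_0_left)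
    have lin: "A * C' - A' * C = (B' * C - B * C') * u"
      "u * (A * B' - A' * B) = (A' * C - A * C') * v"
      if "A + B * u + C * v = 0" "A' + B' * u + C' * v = 0" for u v
    proof -
      have "A * C' - A' * C - (B' * C - B * C') * u = (A + B * u + C * v) * C' - (A' + B' * u + C' * v) * C"
        by (simp add: algebra_simps)
      then show "A * C' - A' * C = (B' * C - B * C') * u" using that by simp
      have "u * (A * B' - A' * B) - (A' * C - A * C') * v
          = A * (A' + B' * u + C' * v) - A' * (A + B * u + C * v)"
        by (simp add: algebra_simps)
      then show "u * (A * B' - A' * B) = (A' * C - A * C') * v" using that by simp
    qed
    have 1: "(A * C' - A' * C) = (B' * C - B * C') * x ^ p" if "A + B * x ^ p + C * x ^ q = 0" for x
    proof -
      have "A' + B' * x ^ p + C' * x ^ q = 0" using R[OF s0[OF that]] that by simp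
      from lin(1)[OF that this] show ?thesis .
    qed
    have 2: "(A * B' - A' * B) = (A' * C - A * C') * x ^ (q - p)"
      if "A + B * x ^ p + C * x ^ q = 0" for x
    proof -
      have "A' + B' * x ^ p + C' * x ^ q = 0" using R[OF s0[OF that]] that by simp
      moreover have "x ^ q = x ^ p * x ^ (q - p)" using pq' by (simp flip: power_add)
      ultimately have "x ^ p * (A * B' - A' * B) = x ^ p * ((A' * C - A * C') * x ^ (q - p))"
        using lin(2)[OF that] by (simp add: mult_ac)
      then show ?thesis using s0[OF that] by simp
    qed
    have "B' * C - B * C' \<noteq> 0" using 1[OF s] ne by auto
    then have "s ^ p = t ^ p" using trans[OF 1[OF s, symmetric] 1[OF t]] by simp
    moreover have "A' * C - A * C' \<noteq> 0" using ne by simp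
    then have "s ^ (q - p) = t ^ (q - p)" using trans[OF 2[OF s, symmetric] 2[OF t]] by simp
    ultimately show ?thesis by blast
  qed
  obtain f where f: "\<And>s. poly f s = A + B * s ^ p + C * s ^ q" "degree f = q"
    using trinomial_poly[OF pq' nz(2)] by blast
  then obtain z where "poly f z = 0" using alg_closed_imp_poly_has_root[of f] pq' by auto
  then have z: "A + B * z ^ p + C * z ^ q = 0" by (simp add: f)
  then have z0: "z \<noteq> 0" using nz pq' by (auto simp: power_0_left)
  have uniq: "s = z" if s: "A + B * s ^ p + C * s ^ q = 0" for s
  proof -
    have "s \<noteq> 0" using s nz pq' by (auto simp: power_0_left)
    have e: "(s / z) ^ p = 1" "(s / z) ^ (q - p) = 1"
      using same[OF s z] z0 by (auto simp: power_divide)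
    have "(s / z) ^ q = (s / z) ^ p * (s / z) ^ (q - p)" using pq' by (simp flip: power_add)
    with e have eq: "(s / z) ^ q = 1" by simp
    \<comment> \<open>By Bezout, an element whose \<open>p\<close>-th and \<open>q\<close>-th powers
      are both 1 is itself 1.\<close>
    obtain x y where xy: "p * x = q * y + 1"
      using bezout_nat[of p q] pq' pq(3) by auto
    have "1 = ((s / z) ^ p) ^ x" using e by simp
    also have "\<dots> = ((s / z) ^ q) ^ y * (s / z)" unfolding power_mult[symmetric] xy by simp
    finally have "s / z = 1" unfolding eq by simp
    then show ?thesis using z0 by simp
  qed
  have "A * C' = A' * C"
  proof (rule trinomial_roots_determine_ratio_coprime[OF pq' nz uniq])
    fix s assume s: "A' + B' * s ^ p + C' * s ^ q = 0"
    then have "s \<noteq> 0" using nz pq' by (auto simp: power_0_left)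
    then have "A + B * s ^ p + C * s ^ q = 0" using R s by simp
    then show "s = z" by (rule uniq)
  qed
  with ne show False by simp
qed

section \<open>Farkas' lemma over the rationals\<close>

text \<open>Vectors are functions, so that one Farkas lemma serves both coordinate vectors and
  affine functionals evaluated at the characters.\<close>

definition lin_closed :: "('x \<Rightarrow> rat) set \<Rightarrow> bool" where
  "lin_closed L \<longleftrightarrow> (\<forall>u\<in>L. \<forall>v\<in>L. \<forall>c d. (\<lambda>x. c * u x + d * v x) \<in> L)"

definition linear_on :: "('x \<Rightarrow> rat) set \<Rightarrow> (('x \<Rightarrow> rat) \<Rightarrow> rat) \<Rightarrow> bool" where
  "linear_on L f \<longleftrightarrow> (\<forall>u\<in>L. \<forall>v\<in>L. \<forall>c d. f (\<lambda>x. c * u x + d * v x) = c * f u + d * f v)"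

lemma lin_closedD: "lin_closed L \<Longrightarrow> u \<in> L \<Longrightarrow> v \<in> L \<Longrightarrow> (\<lambda>x. c * u x + d * v x) \<in> L"
  by (simp add: lin_closed_def)

lemma linear_onD:
  "linear_on L f \<Longrightarrow> u \<in> L \<Longrightarrow> v \<in> L \<Longrightarrow> f (\<lambda>x. c * u x + d * v x) = c * f u + d * f v"
  by (simp add: linear_on_def)

text \<open>Bartl's proof of Farkas' lemma: eliminating one generator amounts to projecting the space along
  a vector on which the remaining generators fail to imply the inequality.\<close>

lemma farkas:
  assumes "finite K" "lin_closed L" "\<And>k. k \<in> K \<Longrightarrow> linear_on L (a k)" "linear_on L b"
    and "\<And>u. u \<in> L \<Longrightarrow> \<forall>k\<in>K. a k u \<le> 0 \<Longrightarrow> b u \<le> 0"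
  shows "\<exists>lam. (\<forall>k\<in>K. 0 \<le> lam k) \<and> (\<forall>u\<in>L. b u = (\<Sum>k\<in>K. lam k * a k u))"
  using assms(1,3-)
proof (induction K arbitrary: a b rule: finite_induct)
  case empty
  have "b u = 0" if "u \<in> L" for u
  proof -
    have "(\<lambda>x. (- 1) * u x + 0 * u x) \<in> L" by (rule lin_closedD[OF assms(2) that that])
    then have "b (\<lambda>x. (- 1) * u x + 0 * u x) \<le> 0" using empty.prems(3) by blast
    then have "- b u \<le> 0" using linear_onD[OF empty.prems(2) that that, of "- 1" 0] by simp
    moreover have "b u \<le> 0" using empty.prems(3) that by blast
    ultimately show ?thesis by simp
  qed
  then show ?case by simp
next
  case (insert m K)
  have lin: "linear_on L (a k)" if "k \<in> insert m K" for k using insert.prems(1) that .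
  note linb = insert.prems(2)
  show ?case
  proof (cases "\<forall>u\<in>L. (\<forall>k\<in>K. a k u \<le> 0) \<longrightarrow> b u \<le> 0")
    case True
    then obtain lam where lam: "\<forall>k\<in>K. 0 \<le> lam k" "\<forall>u\<in>L. b u = (\<Sum>k\<in>K. lam k * a k u)"
      using insert.IH[of a b] lin linb by blast
    show ?thesis
      using lam insert.hyps by (intro exI[of _ "lam(m := 0)"]) (auto intro!: sum.cong)
  next
    case False
    then obtain w where w: "w \<in> L" "\<forall>k\<in>K. a k w \<le> 0" "b w > 0" by force
    then have am: "a m w > 0" using insert.prems(3)[of w] by force
    define u0 where "u0 = (\<lambda>x. (1 / a m w) * w x + 0 * w x)"
    have u0: "u0 \<in> L" unfolding u0_def by (rule lin_closedD[OF assms(2) w(1) w(1)])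
    have ev0: "f u0 = f w / a m w" if "linear_on L f" for f
      using linear_onD[OF that w(1) w(1), of "1 / a m w" 0] by (simp add: u0_def)
    have am0: "a m u0 = 1" using ev0[OF lin] am by simp
    have ak0: "a k u0 \<le> 0" if "k \<in> K" for k
      using ev0[OF lin[of k]] w(2) am that by (auto intro: divide_nonpos_pos)
    have b0: "b u0 > 0" using ev0[OF linb] w(3) am by simp
    \<comment> \<open>Projection along \<open>u0\<close> onto the kernel of
      \<open>a m\<close>.\<close>
    define pr where "pr u = (\<lambda>x. 1 * u x + (- a m u) * u0 x)" for u
    have pr: "pr u \<in> L" if "u \<in> L" for u
      unfolding pr_def by (rule lin_closedD[OF assms(2) that u0])
    have evpr: "f (pr u) = f u - a m u * f u0" if "linear_on L f" "u \<in> L" for f u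
      using linear_onD[OF that(1,2) u0, of 1 "- a m u"] by (simp add: pr_def)
    have linpr: "linear_on L (\<lambda>u. f u - a m u * f u0)" if "linear_on L f" for f
      unfolding linear_on_def
    proof (intro ballI allI)
      fix u v c d assume uv: "u \<in> L" "v \<in> L"
      show "f (\<lambda>x. c * u x + d * v x) - a m (\<lambda>x. c * u x + d * v x) * f u0 =
            c * (f u - a m u * f u0) + d * (f v - a m v * f u0)"
        using linear_onD[OF that uv] linear_onD[OF lin uv] by (simp add: algebra_simps)
    qed
    have "\<exists>lam. (\<forall>k\<in>K. 0 \<le> lam k) \<and>
        (\<forall>u\<in>L. b u - a m u * b u0 = (\<Sum>k\<in>K. lam k * (a k u - a m u * a k u0)))"
    proof (rule insert.IH)
      fix u assume u: "u \<in> L" and le: "\<forall>k\<in>K. a k u - a m u * a k u0 \<le> 0"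
      have "\<forall>k\<in>insert m K. a k (pr u) \<le> 0"
        using evpr[OF lin u] le am0 by auto
      then have "b (pr u) \<le> 0" using insert.prems(3) pr[OF u] by blast
      then show "b u - a m u * b u0 \<le> 0" using evpr[OF linb u] by simp
    qed (use linpr lin linb in auto)
    then obtain lam where lam: "\<forall>k\<in>K. 0 \<le> lam k"
      "\<And>u. u \<in> L \<Longrightarrow> b u - a m u * b u0 = (\<Sum>k\<in>K. lam k * (a k u - a m u * a k u0))" by blast
    \<comment> \<open>The coefficient of \<open>a m\<close> is read off at \<open>u0\<close>, where
      \<open>a m\<close> is 1; it is nonnegative since \<open>b\<close> is positive and the other
      generators are nonpositive there.\<close>
    define c where "c = b u0 - (\<Sum>k\<in>K. lam k * a k u0)"
    have "(\<Sum>k\<in>K. lam k * a k u0) \<le> 0"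
      using lam(1) ak0 by (intro sum_nonpos) (auto intro: mult_nonneg_nonpos)
    then have c: "c \<ge> 0" using b0 by (simp add: c_def)
    have "b u = (\<Sum>k\<in>insert m K. (lam(m := c)) k * a k u)" if "u \<in> L" for u
    proof -
      have "(\<Sum>k\<in>insert m K. (lam(m := c)) k * a k u) = c * a m u + (\<Sum>k\<in>K. lam k * a k u)"
        using insert.hyps by (simp, intro sum.cong) auto
      also have "\<dots> = b u"
        using lam(2)[OF that] by (simp add: c_def algebra_simps sum_subtractf sum_distrib_left)
      finally show ?thesis by simp
    qed
    then show ?thesis using lam(1) c by (intro exI[of _ "lam(m := c)"]) auto
  qed
qed

lemma linear_on_dot: "linear_on UNIV (\<lambda>u. s * (\<Sum>j<r. u j * w j))"
    "linear_on UNIV (\<lambda>u. \<Sum>j<r. u j * w j)"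
    "linear_on UNIV (\<lambda>u. - (\<Sum>j<r. u j * w j))"
  by (simp_all add: linear_on_def algebra_simps sum.distrib sum_distrib_left)

text \<open>Farkas' lemma with every generator taken in both signs; a functional that vanishes on
  the generators but is positive on \<open>w\<close> is rescaled to the value 1.\<close>

lemma in_span_or_separated:
  fixes v :: "'i \<Rightarrow> nat \<Rightarrow> rat"
  assumes "finite K"
  shows "(\<exists>d. \<forall>j<r. w j = (\<Sum>k\<in>K. d k * v k j)) \<or>
    (\<exists>f. (\<forall>k\<in>K. (\<Sum>j<r. f j * v k j) = 0) \<and> (\<Sum>j<r. f j * w j) = 1)"
proof (cases "\<forall>u. (\<forall>k\<in>K. (\<Sum>j<r. u j * v k j) = 0) \<longrightarrow> (\<Sum>j<r. u j * w j) \<le> 0")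
  case True
  define a where "a = (\<lambda>(k, s::rat) u. s * (\<Sum>j<r. u j * v k j))"
  have "\<exists>lam. (\<forall>p\<in>K \<times> {1, -1}. 0 \<le> lam p) \<and>
      (\<forall>u\<in>UNIV. (\<Sum>j<r. u j * w j) = (\<Sum>p\<in>K \<times> {1, -1}. lam p * a p u))"
  proof (rule farkas)
    fix u :: "nat \<Rightarrow> rat" assume "u \<in> UNIV" and le: "\<forall>p\<in>K \<times> {1, -1}. a p u \<le> 0"
    have "(\<Sum>j<r. u j * v k j) = 0" if "k \<in> K" for k
      using le[rule_format, of "(k, 1)"] le[rule_format, of "(k, -1)"] that by (simp add: a_def)
    then show "(\<Sum>j<r. u j * w j) \<le> 0" using True by blast
  qed (use assms in \<open>auto simp: lin_closed_def a_def linear_on_dot\<close>)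
  then obtain lam where lam:
    "\<And>u. (\<Sum>j<r. u j * w j) = (\<Sum>p\<in>K \<times> {1, -1}. lam p * a p u)" by blast
  have "w i = (\<Sum>k\<in>K. (lam (k, 1) - lam (k, -1)) * v k i)" if "i < r" for i
  proof -
    have e: "(\<Sum>j<r. of_bool (j = i) * g j) = g i" for g :: "nat \<Rightarrow> rat"
      using that by (simp add: if_distrib[of "\<lambda>x. x * _"] sum.If_cases of_bool_def cong: if_cong)
    have "w i = (\<Sum>p\<in>K \<times> {1, -1}. lam p * a p (\<lambda>j. of_bool (j = i)))"
      using lam[of "\<lambda>j. of_bool (j = i)"] by (simp add: e)
    also have "\<dots> = (\<Sum>k\<in>K. \<Sum>s\<in>{1, -1}. lam (k, s) * (s * v k i))"
      unfolding sum.cartesian_product by (intro sum.cong) (auto simp: a_def e)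
    finally show ?thesis by (simp add: algebra_simps)
  qed
  then show ?thesis by (intro disjI1 exI[of _ "\<lambda>k. lam (k, 1) - lam (k, -1)"]) blast
next
  case False
  then obtain u where u: "\<forall>k\<in>K. (\<Sum>j<r. u j * v k j) = 0" "(\<Sum>j<r. u j * w j) > 0" by force
  define f where "f j = u j / (\<Sum>j<r. u j * w j)" for j
  have "(\<Sum>j<r. f j * g j) = (\<Sum>j<r. u j * g j) / (\<Sum>j<r. u j * w j)" for g
    by (simp add: f_def sum_divide_distrib)
  with u show ?thesis by (intro disjI2 exI[of _ f]) auto
qed

text \<open>A generator depending on the others is dropped; the coefficient of an independent one is
  read off, hence bounded, by a functional vanishing on the others. Over the rationals this stands
  in for a compactness argument.\<close>

lemma bounded_coefficients:
  fixes v :: "'i \<Rightarrow> nat \<Rightarrow> rat"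
  assumes "finite K"
  shows "\<exists>C\<ge>0. \<forall>d m. 0 \<le> m \<longrightarrow> (\<forall>j<r. \<bar>\<Sum>k\<in>K. d k * v k j\<bar> \<le> m) \<longrightarrow>
    (\<exists>d'. (\<forall>j<r. (\<Sum>k\<in>K. d' k * v k j) = (\<Sum>k\<in>K. d k * v k j)) \<and> (\<forall>k\<in>K. \<bar>d' k\<bar> \<le> C * m))"
  using assms
proof (induction K rule: finite_induct)
  case (insert p K)
  then obtain C where C: "C \<ge> 0"
    "\<And>d m. 0 \<le> m \<Longrightarrow> \<forall>j<r. \<bar>\<Sum>k\<in>K. d k * v k j\<bar> \<le> m \<Longrightarrow>
    (\<exists>d'. (\<forall>j<r. (\<Sum>k\<in>K. d' k * v k j) = (\<Sum>k\<in>K. d k * v k j)) \<and> (\<forall>k\<in>K. \<bar>d' k\<bar> \<le> C * m))"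
    by blast
  have upd: "(\<Sum>k\<in>insert p K. (d(p := c)) k * v k j) = c * v p j + (\<Sum>k\<in>K. d k * v k j)" for d c j
    using insert.hyps by (simp, intro sum.cong) auto
  consider (dep) e where "\<forall>j<r. v p j = (\<Sum>k\<in>K. e k * v k j)"
    | (indep) f where "\<forall>k\<in>K. (\<Sum>j<r. f j * v k j) = 0" "(\<Sum>j<r. f j * v p j) = 1"
    using in_span_or_separated[OF insert.hyps(1), of r "v p" v] by blast
  then show ?case
  proof cases
    case dep
    show ?thesis
    proof (intro exI[of _ C] conjI C(1) allI impI)
      fix d m assume m: "0 \<le> m" and le: "\<forall>j<r. \<bar>\<Sum>k\<in>insert p K. d k * v k j\<bar> \<le> m"
      have eq: "(\<Sum>k\<in>insert p K. d k * v k j) = (\<Sum>k\<in>K. (d k + d p * e k) * v k j)" if "j < r" for j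
        using that dep insert.hyps by (simp add: algebra_simps sum.distrib sum_distrib_left)
      with le have "\<forall>j<r. \<bar>\<Sum>k\<in>K. (d k + d p * e k) * v k j\<bar> \<le> m" by simp
      from C(2)[OF m this] obtain d' where d':
        "\<forall>j<r. (\<Sum>k\<in>K. d' k * v k j) = (\<Sum>k\<in>K. (d k + d p * e k) * v k j)"
        "\<forall>k\<in>K. \<bar>d' k\<bar> \<le> C * m" by blast
      show "\<exists>d'. (\<forall>j<r. (\<Sum>k\<in>insert p K. d' k * v k j) = (\<Sum>k\<in>insert p K. d k * v k j)) \<and>
          (\<forall>k\<in>insert p K. \<bar>d' k\<bar> \<le> C * m)"
        using d' eq C(1) m by (intro exI[of _ "d'(p := 0)"]) (simp add: upd del: fun_upd_apply, simp)
    qed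
  next
    case indep
    define A where "A = (\<Sum>j<r. \<bar>f j\<bar>)"
    define B where "B = (\<Sum>j<r. \<bar>v p j\<bar>)"
    have AB: "A \<ge> 0" "B \<ge> 0" by (auto simp: A_def B_def intro: sum_nonneg)
    \<comment> \<open>The coefficient of \<open>p\<close> is at most \<open>A * m\<close>; once its
      term is removed, the rest has norm at most \<open>(1 + A * B) * m\<close>.\<close>
    show ?thesis
    proof (intro exI[of _ "C * (1 + A * B) + A"] conjI allI impI)
      show "0 \<le> C * (1 + A * B) + A" using C(1) AB by simp
      fix d m assume m: "0 \<le> m" and le: "\<forall>j<r. \<bar>\<Sum>k\<in>insert p K. d k * v k j\<bar> \<le> m"
      have ins: "(\<Sum>k\<in>insert p K. d k * v k j) = d p * v p j + (\<Sum>k\<in>K. d k * v k j)" for j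
        using insert.hyps by simp
      have "(\<Sum>j<r. f j * (\<Sum>k\<in>K. d k * v k j)) = (\<Sum>k\<in>K. d k * (\<Sum>j<r. f j * v k j))"
        unfolding sum_distrib_left by (subst sum.swap) (simp add: mult_ac)
      then have dp: "d p = (\<Sum>j<r. f j * (\<Sum>k\<in>insert p K. d k * v k j))"
        using indep by (simp add: ins algebra_simps sum.distrib flip: sum_distrib_left)
      have "\<bar>d p\<bar> \<le> (\<Sum>j<r. \<bar>f j\<bar> * m)"
        unfolding dp using le by (intro order_trans[OF sum_abs] sum_mono) (auto simp: abs_mult intro: mult_left_mono)
      then have dp_le: "\<bar>d p\<bar> \<le> A * m" by (simp add: A_def sum_distrib_right)
      have "\<bar>\<Sum>k\<in>K. d k * v k j\<bar> \<le> (1 + A * B) * m" if j: "j < r" for j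
      proof -
        have "\<bar>v p j\<bar> \<le> B" unfolding B_def using j by (intro member_le_sum) auto
        then have "\<bar>d p * v p j\<bar> \<le> (A * m) * B"
          unfolding abs_mult using dp_le AB m by (intro mult_mono) auto
        moreover have "\<bar>\<Sum>k\<in>insert p K. d k * v k j\<bar> \<le> m" using le j by blast
        ultimately show ?thesis using ins[of j] by (simp add: algebra_simps)
      qed
      then have "\<forall>j<r. \<bar>\<Sum>k\<in>K. d k * v k j\<bar> \<le> (1 + A * B) * m" by blast
      moreover have "0 \<le> (1 + A * B) * m" using AB m by simp
      ultimately obtain d' where d':
        "\<forall>j<r. (\<Sum>k\<in>K. d' k * v k j) = (\<Sum>k\<in>K. d k * v k j)"
        "\<forall>k\<in>K. \<bar>d' k\<bar> \<le> C * ((1 + A * B) * m)" using C(2) by meson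
      have "A * m \<le> (C * (1 + A * B) + A) * m" "C * ((1 + A * B) * m) \<le> (C * (1 + A * B) + A) * m"
        using AB m C(1) by (simp_all add: algebra_simps)
      then show "\<exists>d'. (\<forall>j<r. (\<Sum>k\<in>insert p K. d' k * v k j) = (\<Sum>k\<in>insert p K. d k * v k j)) \<and>
          (\<forall>k\<in>insert p K. \<bar>d' k\<bar> \<le> (C * (1 + A * B) + A) * m)"
        using d' dp_le by (intro exI[of _ "d'(p := d p)"]) (simp add: upd ins del: fun_upd_apply, auto intro: order_trans)
    qed
  qed
qed (auto intro: exI[of _ 0])

section \<open>The weight polytope\<close>

lemma rat_convex_hull: "rat_convex (rat_convex hull S)"
  by (rule hull_in) (auto simp: rat_convex_def)

lemma rat_affine_hull: "rat_affine (rat_affine hull S)"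
  by (rule hull_in) (auto simp: rat_affine_def)

lemma rat_convex_combination:
  assumes "rat_convex C" "finite A" "\<And>i. i \<in> A \<Longrightarrow> vec r (p i) \<in> C"
    and "\<And>i. i \<in> A \<Longrightarrow> 0 \<le> w i" "sum w A = 1"
  shows "vec r (\<lambda>j. \<Sum>i\<in>A. w i * p i j) \<in> C"
  using assms(2-)
proof (induction A arbitrary: w rule: finite_induct)
  case (insert a A)
  have s: "w a + sum w A = 1" using insert by simp
  show ?case
  proof (cases "sum w A = 0")
    case True
    then have "\<forall>i\<in>A. w i = 0" using insert by (subst (asm) sum_nonneg_eq_0_iff) auto
    then have "vec r (\<lambda>j. \<Sum>i\<in>insert a A. w i * p i j) = vec r (p a)"
      using s True insert.hyps by auto
    then show ?thesis using insert.prems(1) by simp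
  next
    case False
    define t where "t = sum w A"
    have t: "t > 0" using False insert.prems(2) unfolding t_def
      by (metis insertCI less_eq_rat_def sum_nonneg)
    have "vec r (\<lambda>j. \<Sum>i\<in>A. (w i / t) * p i j) \<in> C"
      using insert.prems t by (intro insert.IH) (auto simp: sum_divide_distrib[symmetric] t_def)
    then have "w a \<cdot>\<^sub>v vec r (p a) + t \<cdot>\<^sub>v vec r (\<lambda>j. \<Sum>i\<in>A. (w i / t) * p i j) \<in> C"
      using assms(1) insert.prems t s unfolding rat_convex_def t_def by (meson insertI1 less_imp_le)
    also have "w a \<cdot>\<^sub>v vec r (p a) + t \<cdot>\<^sub>v vec r (\<lambda>j. \<Sum>i\<in>A. (w i / t) * p i j)
        = vec r (\<lambda>j. \<Sum>i\<in>insert a A. w i * p i j)"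
      using t insert.hyps by (intro eq_vecI) (auto simp: sum_distrib_left)
    finally show ?thesis .
  qed
qed simp

lemma sum_of_bool_mult:
  assumes "i < (m::nat)"
  shows "(\<Sum>k<m. of_bool (k = i) * f k) = (f i :: rat)"
proof -
  have "(\<Sum>k<m. of_bool (k = i) * f k) = (\<Sum>k<m. if k = i then f k else 0)"
    by (intro sum.cong) auto
  then show ?thesis using assms by (simp add: sum.delta)
qed

lemma common_denominator:
  fixes v :: "'i \<Rightarrow> rat"
  assumes "finite A"
  obtains N :: nat and c :: "'i \<Rightarrow> int" where "N > 0" "\<And>l. l \<in> A \<Longrightarrow> of_nat N * v l = of_int (c l)"
proof -
  have "\<exists>N::nat. N > 0 \<and> (\<forall>l\<in>A. \<exists>c::int. of_nat N * v l = of_int c)"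
    using assms
  proof (induction A rule: finite_induct)
    case (insert a A)
    then obtain N :: nat where N: "N > 0" "\<forall>l\<in>A. \<exists>c::int. of_nat N * v l = of_int c" by auto
    obtain p q where pq: "quotient_of (v a) = (p, q)" by fastforce
    have q: "q > 0" "v a = of_int p / of_int q"
      using pq quotient_of_denom_pos quotient_of_div by auto
    show ?case
    proof (rule exI[of _ "N * nat q"], intro conjI ballI)
      show "N * nat q > 0" using N q by simp
      fix l assume "l \<in> insert a A"
      then consider "l = a" | "l \<in> A" by blast
      then show "\<exists>c::int. of_nat (N * nat q) * v l = of_int c"
      proof cases
        case 1
        have "of_nat (N * nat q) * v a = of_int (of_nat N * p)" using q by (simp add: field_simps)
        then show ?thesis using 1 by blast
      next
        case 2
        then obtain c :: int where "of_nat N * v l = of_int c" using N by blast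
        then have "of_nat (N * nat q) * v l = of_int (c * q)" using q by (simp add: mult_ac)
        then show ?thesis by blast
      qed
    qed
  qed (auto intro: exI[of _ 1])
  then obtain N :: nat where N: "N > 0" "\<forall>l\<in>A. \<exists>c::int. of_nat N * v l = of_int c" by blast
  obtain c :: "'i \<Rightarrow> int" where "\<forall>l\<in>A. of_nat N * v l = of_int (c l)"
    using bchoice[OF N(2)] by blast
  then show ?thesis using that N(1) by blast
qed

section \<open>Affine functionals and minimal faces\<close>

locale weights =
  fixes r n :: nat and chi :: "nat \<Rightarrow> int vec"
  assumes chi: "i < n \<Longrightarrow> chi i \<in> carrier_vec r"
begin

definition wt :: "nat \<Rightarrow> nat \<Rightarrow> rat" where "wt i j = of_int (chi i $ j)"

definition convex_weights :: "(nat \<Rightarrow> rat) \<Rightarrow> bool" where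
  "convex_weights w \<longleftrightarrow> (\<forall>i<n. 0 \<le> w i) \<and> sum w {..<n} = 1"

definition comb :: "(nat \<Rightarrow> rat) \<Rightarrow> rat vec" where
  "comb w = vec r (\<lambda>j. \<Sum>i<n. w i * wt i j)"

lemma comb_index [simp]: "j < r \<Longrightarrow> comb w $ j = (\<Sum>i<n. w i * wt i j)"
  and dim_comb [simp]: "dim_vec (comb w) = r"
  by (simp_all add: comb_def)

lemma rat_point_chi: "i < n \<Longrightarrow> rat_point (chi i) = vec r (wt i)"
  using chi[of i] by (intro eq_vecI) (auto simp: rat_point_def wt_def)

lemma comb_unit: "i < n \<Longrightarrow> comb (\<lambda>k. of_bool (k = i)) = vec r (wt i)"
  by (intro eq_vecI) (auto simp: sum_of_bool_mult)

lemma convex_weights_unit: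
  assumes "i < n"
  shows "convex_weights (\<lambda>k. of_bool (k = i))"
proof -
  have "(\<Sum>k<n. of_bool (k = i)) = (1 :: rat)"
    using sum_of_bool_mult[OF assms, of "\<lambda>_. 1"] by (simp only: mult_1_right)
  then show ?thesis unfolding convex_weights_def by simp
qed

lemma weight_polytope_eq: "weight_polytope n chi = {comb w | w. convex_weights w}"
proof
  have "rat_convex {comb w | w. convex_weights w}"
    unfolding rat_convex_def
  proof (safe)
    fix v w s t assume *: "convex_weights v" "convex_weights w" "0 \<le> s" "0 \<le> t" "s + t = (1::rat)"
    have "s \<cdot>\<^sub>v comb v + t \<cdot>\<^sub>v comb w = comb (\<lambda>i. s * v i + t * w i)"
      by (intro eq_vecI) (auto simp: algebra_simps sum.distrib sum_distrib_left)
    moreover have "convex_weights (\<lambda>i. s * v i + t * w i)"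
      using * by (simp add: convex_weights_def sum.distrib flip: sum_distrib_left)
    ultimately show "\<exists>w'. s \<cdot>\<^sub>v comb v + t \<cdot>\<^sub>v comb w = comb w' \<and> convex_weights w'" by blast
  qed
  moreover have "rat_point ` chi ` {..<n} \<subseteq> {comb w | w. convex_weights w}"
    using convex_weights_unit comb_unit rat_point_chi by force
  ultimately show "weight_polytope n chi \<subseteq> {comb w | w. convex_weights w}"
    unfolding weight_polytope_def by (intro hull_minimal)
next
  have "comb w \<in> weight_polytope n chi" if "convex_weights w" for w
    unfolding comb_def weight_polytope_def
    using that by (intro rat_convex_combination rat_convex_hull)
      (auto simp: convex_weights_def rat_point_chi[symmetric] intro: hull_inc)
  then show "{comb w | w. convex_weights w} \<subseteq> weight_polytope n chi" by blast
qed

text \<open>Affine functionals on the character space are only ever evaluated at the characters, so they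
  are represented by the functions of the index that they induce.\<close>

definition functionals :: "(nat \<Rightarrow> rat) set" where
  "functionals = {\<lambda>i. c + (\<Sum>j<r. w j * wt i j) | c w. True}"

lemma lin_closed_functionals: "lin_closed functionals"
  unfolding lin_closed_def
proof (intro ballI allI)
  fix u v c d assume "u \<in> functionals" "v \<in> functionals"
  then obtain a b x y where uv: "u = (\<lambda>i. a + (\<Sum>j<r. x j * wt i j))"
    "v = (\<lambda>i. b + (\<Sum>j<r. y j * wt i j))" unfolding functionals_def by blast
  have "(\<lambda>i. c * u i + d * v i)
      = (\<lambda>i. (c * a + d * b) + (\<Sum>j<r. (c * x j + d * y j) * wt i j))"
    by (simp add: uv algebra_simps sum.distrib sum_distrib_left)
  then show "(\<lambda>i. c * u i + d * v i) \<in> functionals" unfolding functionals_def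
    by (intro CollectI exI[of _ "c * a + d * b"] exI[of _ "\<lambda>j. c * x j + d * y j"]) simp
qed

lemmas functionals_lin = lin_closedD[OF lin_closed_functionals]

lemma functionals_const: "(\<lambda>_. c) \<in> functionals"
  unfolding functionals_def by (intro CollectI exI[of _ c] exI[of _ "\<lambda>_. 0"]) simp

lemma functionals_add: "u \<in> functionals \<Longrightarrow> v \<in> functionals \<Longrightarrow> (\<lambda>i. u i + v i) \<in> functionals"
  using functionals_lin[of u v 1 1] by simp

lemma functionals_scale: "u \<in> functionals \<Longrightarrow> (\<lambda>i. c * u i) \<in> functionals"
  using functionals_lin[of u u c 0] by simp

lemma functionals_uminus: "u \<in> functionals \<Longrightarrow> (\<lambda>i. - u i) \<in> functionals"
  using functionals_lin[of u u "-1" 0] by simp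

lemma functionals_dot: "(\<lambda>i. (\<Sum>j<r. w j * wt i j)) \<in> functionals"
  unfolding functionals_def by (intro CollectI exI[of _ 0] exI[of _ w]) simp

lemma functionals_coord: "j < r \<Longrightarrow> (\<lambda>i. wt i j) \<in> functionals"
  using functionals_dot[of "\<lambda>k. of_bool (k = j)"] by (simp only: sum_of_bool_mult)

text \<open>\<open>in_minimal_face j i\<close> says that every face containing the \<open>i\<close>-th character contains the \<open>j\<close>-th.\<close>

definition in_minimal_face :: "nat \<Rightarrow> nat \<Rightarrow> bool" where
  "in_minimal_face j i \<longleftrightarrow> (\<forall>u\<in>functionals. (\<forall>l<n. u l \<le> u i) \<longrightarrow> u j = u i)"

lemma in_minimal_face_refl: "in_minimal_face i i" by (simp add: in_minimal_face_def)

lemma in_minimal_face_trans: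
  assumes "in_minimal_face k j" "in_minimal_face j i"
  shows "in_minimal_face k i"
  unfolding in_minimal_face_def
proof (intro ballI impI)
  fix u assume u: "u \<in> functionals" "\<forall>l<n. u l \<le> u i"
  then have ji: "u j = u i" using assms(2) by (simp add: in_minimal_face_def)
  then have "\<forall>l<n. u l \<le> u j" using u(2) by simp
  then have "u k = u j" using assms(1) u(1) by (simp add: in_minimal_face_def)
  then show "u k = u i" using ji by simp
qed

text \<open>Each character outside the minimal face is excluded by some functional maximal at
  \<open>i\<close>; the sum of these finitely many functionals excludes all of them.\<close>

lemma minimal_face_functional:
  obtains u where "u \<in> functionals" "\<forall>l<n. u l \<le> u i"
    "\<And>l. l < n \<Longrightarrow> u l = u i \<longleftrightarrow> in_minimal_face l i"
proof -
  have "\<exists>u\<in>functionals. (\<forall>l<n. u l \<le> u i) \<and> (\<forall>l\<in>A. u l < u i)"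
    if "finite A" "\<And>l. l \<in> A \<Longrightarrow> l < n \<and> \<not> in_minimal_face l i" for A
    using that
  proof (induction A rule: finite_induct)
    case empty
    show ?case using functionals_const by (intro bexI[of _ "\<lambda>_. 0"]) auto
  next
    case (insert a A)
    have "\<exists>u\<in>functionals. (\<forall>l<n. u l \<le> u i) \<and> (\<forall>l\<in>A. u l < u i)"
      by (rule insert.IH) (rule insert.prems, rule insertI2)
    then obtain u where u: "u \<in> functionals" "\<forall>l<n. u l \<le> u i" "\<forall>l\<in>A. u l < u i" by blast
    have "\<not> in_minimal_face a i" using insert.prems[of a] by simp
    then obtain v where v: "v \<in> functionals" "\<forall>l<n. v l \<le> v i" "v a \<noteq> v i"
      unfolding in_minimal_face_def by blast
    have va: "v a < v i" using v insert.prems[of a] by (simp add: order_less_le)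
    have "u l + v l < u i + v i" if "l \<in> insert a A" for l
    proof (cases "l = a")
      case True
      then show ?thesis using va u(2) insert.prems[of a] by (simp add: add_le_less_mono)
    next
      case False
      then show ?thesis using u(3) v(2) insert.prems[of l] that by (simp add: add_less_le_mono)
    qed
    moreover have "\<forall>l<n. u l + v l \<le> u i + v i" using u(2) v(2) by (simp add: add_mono)
    ultimately show ?case using functionals_add[OF u(1) v(1)] by (intro bexI[of _ "\<lambda>l. u l + v l"] conjI) simp_all
  qed
  note ex = this
  have "\<exists>u\<in>functionals. (\<forall>l<n. u l \<le> u i) \<and> (\<forall>l\<in>{l. l < n \<and> \<not> in_minimal_face l i}. u l < u i)"
    by (rule ex) simp_all
  then obtain u where u: "u \<in> functionals" "\<forall>l<n. u l \<le> u i"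
    and less: "\<forall>l\<in>{l. l < n \<and> \<not> in_minimal_face l i}. u l < u i" by blast
  have "u l = u i \<longleftrightarrow> in_minimal_face l i" if "l < n" for l
  proof
    assume "u l = u i"
    then show "in_minimal_face l i" using less that by force
  next
    assume "in_minimal_face l i"
    then show "u l = u i" using u by (simp add: in_minimal_face_def)
  qed
  then show ?thesis using u by (rule that[rotated 2])
qed

text \<open>Functionals maximal at \<open>i\<close> are constant on the minimal face
  \<open>K\<close>, so Farkas' lemma writes the sum over \<open>K\<close> of the
  \<open>u i - u l\<close> as a nonnegative combination of the \<open>u k - u i\<close>. Solved for
  \<open>u i\<close>, this is a convex combination giving every element of \<open>K\<close> positive
  weight.\<close>

lemma positive_weights_on_minimal_face:
  assumes i: "i < n"
  obtains w where "convex_weights w" "\<And>k. k < n \<Longrightarrow> 0 < w k \<longleftrightarrow> in_minimal_face k i" "comb w = vec r (wt i)"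
proof -
  obtain u where u: "u \<in> functionals" "\<forall>l<n. u l \<le> u i" "\<And>l. l < n \<Longrightarrow> u l = u i \<longleftrightarrow> in_minimal_face l i"
    using minimal_face_functional by blast
  define K where "K = {k. k < n \<and> in_minimal_face k i}"
  have finK: "finite K" by (simp add: K_def)
  have iK: "i \<in> K" using i by (simp add: K_def in_minimal_face_refl)
  have "\<exists>lam. (\<forall>k\<in>{..<n}. 0 \<le> lam k) \<and>
     (\<forall>u\<in>functionals. (\<Sum>l\<in>K. u i - u l) = (\<Sum>k<n. lam k * (u k - u i)))"
  proof (rule farkas[OF _ lin_closed_functionals])
    fix v assume v: "v \<in> functionals" "\<forall>k\<in>{..<n}. v k - v i \<le> 0"
    then have "\<forall>l\<in>K. v l = v i" unfolding K_def in_minimal_face_def by simp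
    then show "(\<Sum>l\<in>K. v i - v l) \<le> 0" by simp
  qed (auto simp: linear_on_def algebra_simps sum.distrib sum_distrib_left sum_subtractf)
  then obtain lam where lam: "\<And>k. k < n \<Longrightarrow> 0 \<le> lam k"
    "\<And>v. v \<in> functionals \<Longrightarrow> (\<Sum>l\<in>K. v i - v l) = (\<Sum>k<n. lam k * (v k - v i))" by blast
  define S where "S = of_nat (card K) + sum lam {..<n}"
  have "card K > 0" using finK iK by (auto simp: card_gt_0_iff)
  then have S: "S > 0" using lam(1) by (auto simp: S_def intro!: add_pos_nonneg sum_nonneg)
  define w where "w k = (of_bool (k \<in> K) + lam k) / S" for k
  have ofK: "(\<Sum>k<n. of_bool (k \<in> K) * g k) = sum g K" for g :: "nat \<Rightarrow> rat"
  proof -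
    have "{..<n} \<inter> K = K" by (auto simp: K_def)
    then show ?thesis by (simp add: of_bool_def if_distrib[of "\<lambda>x. x * _"] sum.If_cases cong: if_cong)
  qed
  have rep: "v i = (\<Sum>k<n. w k * v k)" if "v \<in> functionals" for v
  proof -
    have "of_nat (card K) * v i - sum v K = (\<Sum>k<n. lam k * v k) - sum lam {..<n} * v i"
      using lam(2)[OF that] by (simp add: sum_subtractf algebra_simps sum_distrib_left)
    then have "S * v i = sum v K + (\<Sum>k<n. lam k * v k)" by (simp add: S_def algebra_simps)
    also have "\<dots> = (\<Sum>k<n. (of_bool (k \<in> K) + lam k) * v k)"
      by (simp add: algebra_simps sum.distrib flip: ofK)
    also have "\<dots> = S * (\<Sum>k<n. w k * v k)" using S by (simp add: w_def sum_distrib_left)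
    finally show ?thesis using S by simp
  qed
  \<comment> \<open>Testing the identity on \<open>u\<close>, which is strictly smaller off
    \<open>K\<close>, shows that \<open>lam\<close> vanishes there.\<close>
  have "(\<Sum>l\<in>K. u i - u l) = 0" using u(3) by (intro sum.neutral) (metis (mono_tags, lifting) K_def diff_self mem_Collect_eq)
  then have "(\<Sum>k<n. lam k * (u k - u i)) = 0" using lam(2)[OF u(1)] by simp
  moreover have "(\<Sum>k<n. lam k * (u i - u k)) = - (\<Sum>k<n. lam k * (u k - u i))"
    by (simp add: algebra_simps flip: sum_negf)
  ultimately have "(\<Sum>k<n. lam k * (u i - u k)) = 0" by simp
  moreover have "0 \<le> lam k * (u i - u k)" if "k < n" for k using lam(1) u(2) that by simp
  ultimately have "\<forall>k\<in>{..<n}. lam k * (u i - u k) = 0"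
    by (subst (asm) sum_nonneg_eq_0_iff) auto
  then have off: "lam k = 0" if "k < n" "k \<notin> K" for k using that u(3) by (force simp: K_def)
  show ?thesis
  proof
    show "convex_weights w"
      using lam(1) S rep[OF functionals_const[of 1]] by (auto simp: convex_weights_def w_def)
    show "0 < w k \<longleftrightarrow> in_minimal_face k i" if "k < n" for k
      using that off[of k] lam(1)[of k] S by (auto simp: w_def K_def divide_pos_pos add_pos_nonneg)
    show "comb w = vec r (wt i)"
      using rep[OF functionals_coord] by (intro eq_vecI) auto
  qed
qed

section \<open>Relative interiors of faces\<close>

lemma scalar_prod_comb:
  assumes "convex_weights w" "u = (\<lambda>i. c + (\<Sum>j<r. a j * wt i j))"
  shows "vec r a \<bullet> comb w = (\<Sum>i<n. w i * u i) - c"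
proof -
  have "vec r a \<bullet> comb w = (\<Sum>j<r. \<Sum>i<n. a j * (w i * wt i j))"
    by (simp add: scalar_prod_def atLeast0LessThan sum_distrib_left)
  also have "\<dots> = (\<Sum>i<n. w i * (u i - c))"
    by (subst sum.swap) (simp add: assms(2) sum_distrib_left mult_ac)
  also have "\<dots> = (\<Sum>i<n. w i * u i) - c"
    using assms(1) by (simp add: algebra_simps sum_subtractf convex_weights_def flip: sum_distrib_left)
  finally show ?thesis .
qed

text \<open>The character has weights that are positive on the whole minimal face, and by
  \<open>bounded_coefficients\<close> a small displacement within the affine hull changes them too
  little to make any of them negative.\<close>

lemma in_rel_interior_of_minimal_face:
  assumes i: "i < n" and u: "u = (\<lambda>l. c + (\<Sum>j<r. a j * wt l j))"
    and face: "\<And>l. l < n \<Longrightarrow> u l \<le> m" "\<And>l. l < n \<Longrightarrow> u l = m \<longleftrightarrow> in_minimal_face l i"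
  defines "F \<equiv> {p \<in> weight_polytope n chi. vec r a \<bullet> p = m - c}"
  shows "rat_point (chi i) \<in> rat_rel_interior F"
proof -
  define K where "K = {k. k < n \<and> in_minimal_face k i}"
  have K: "finite K" "K \<subseteq> {..<n}" "i \<in> K" using i by (auto simp: K_def in_minimal_face_refl)
  obtain w where w: "convex_weights w" "\<And>k. k < n \<Longrightarrow> 0 < w k \<longleftrightarrow> in_minimal_face k i" "comb w = vec r (wt i)"
    using positive_weights_on_minimal_face[OF i] by blast
  have restrict: "(\<Sum>k<n. y k * g k) = (\<Sum>k\<in>K. y k * g k)" if "\<And>k. k < n \<Longrightarrow> k \<notin> K \<Longrightarrow> y k = 0"
    for y g :: "nat \<Rightarrow> rat"
    using K that by (intro sum.mono_neutral_right) auto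
  have inF: "comb y \<in> F \<longleftrightarrow> (\<forall>k<n. k \<notin> K \<longrightarrow> y k = 0)" if y: "convex_weights y" for y
  proof -
    have "(\<Sum>k<n. y k * (m - u k)) = m - (\<Sum>k<n. y k * u k)"
      using y by (simp add: algebra_simps sum_subtractf convex_weights_def flip: sum_distrib_left)
    then have "comb y \<in> F \<longleftrightarrow> (\<Sum>k<n. y k * (m - u k)) = 0"
      using y scalar_prod_comb[OF y u] by (auto simp: F_def weight_polytope_eq)
    also have "\<dots> \<longleftrightarrow> (\<forall>k\<in>{..<n}. y k * (m - u k) = 0)"
      using y face(1) by (intro sum_nonneg_eq_0_iff) (auto simp: convex_weights_def)
    also have "\<dots> \<longleftrightarrow> (\<forall>k<n. k \<notin> K \<longrightarrow> y k = 0)"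
      using face(2) by (auto simp: K_def)
    finally show ?thesis .
  qed
  have wK: "w k = 0" if "k < n" "k \<notin> K" for k
    using w(1) w(2)[of k] that unfolding convex_weights_def K_def by force
  have wt_i: "wt i j = (\<Sum>k\<in>K. w k * wt k j)" if "j < r" for j
    using arg_cong[OF w(3), of "\<lambda>v. v $ j"] that restrict[of w, OF wK] by simp
  have sumwK: "sum w K = 1"
    using restrict[of w "\<lambda>_. 1", OF wK] w(1) by (simp add: convex_weights_def)
  \<comment> \<open>Coefficients on differences to the \<open>i\<close>-th character make
    displacements in the affine hull accessible to \<open>bounded_coefficients\<close>.\<close>
  define A where "A = {vec r (\<lambda>j. wt i j + (\<Sum>k\<in>K. d k * (wt k j - wt i j))) | d. True}"
  have "rat_affine A"
    unfolding rat_affine_def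
  proof (intro ballI allI impI)
    fix x y and s t :: rat assume "x \<in> A" "y \<in> A" and st: "s + t = 1"
    then obtain d e where xy: "x = vec r (\<lambda>j. wt i j + (\<Sum>k\<in>K. d k * (wt k j - wt i j)))"
      "y = vec r (\<lambda>j. wt i j + (\<Sum>k\<in>K. e k * (wt k j - wt i j)))" unfolding A_def by blast
    have "s * (b + p) + t * (b + q) = b + (s * p + t * q)" for b p q :: rat
      using arg_cong[OF st, of "\<lambda>z. z * b"] by (simp add: algebra_simps)
    then have "s \<cdot>\<^sub>v x + t \<cdot>\<^sub>v y
        = vec r (\<lambda>j. wt i j + (\<Sum>k\<in>K. (s * d k + t * e k) * (wt k j - wt i j)))"
      by (intro eq_vecI) (simp_all add: xy distrib_right sum.distrib sum_distrib_left mult.assoc)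
    then show "s \<cdot>\<^sub>v x + t \<cdot>\<^sub>v y \<in> A" unfolding A_def by (intro CollectI exI[of _ "\<lambda>k. s * d k + t * e k"]) simp
  qed
  moreover have "F \<subseteq> A"
  proof
    fix p assume p: "p \<in> F"
    then obtain y where y: "p = comb y" "convex_weights y" by (auto simp: F_def weight_polytope_eq)
    then have y0: "\<And>k. k < n \<Longrightarrow> k \<notin> K \<Longrightarrow> y k = 0" using inF p by blast
    have "sum y K = 1" using restrict[of y "\<lambda>_. 1", OF y0] y(2) by (simp add: convex_weights_def)
    then have "wt i j + (\<Sum>k\<in>K. y k * (wt k j - wt i j)) = (\<Sum>k\<in>K. y k * wt k j)" for j
      by (simp add: right_diff_distrib sum_subtractf flip: sum_distrib_right)
    then have "p = vec r (\<lambda>j. wt i j + (\<Sum>k\<in>K. y k * (wt k j - wt i j)))"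
      using y(1) restrict[of y, OF y0] by (simp add: comb_def)
    then show "p \<in> A" unfolding A_def by blast
  qed
  ultimately have aff: "rat_affine hull F \<subseteq> A" by (intro hull_minimal)
  obtain C where C: "C \<ge> 0" "\<And>d m. 0 \<le> m \<Longrightarrow> \<forall>j<r. \<bar>\<Sum>k\<in>K. d k * (wt k j - wt i j)\<bar> \<le> m \<Longrightarrow>
    (\<exists>d'. (\<forall>j<r. (\<Sum>k\<in>K. d' k * (wt k j - wt i j)) = (\<Sum>k\<in>K. d k * (wt k j - wt i j)))
       \<and> (\<forall>k\<in>K. \<bar>d' k\<bar> \<le> C * m))"
    using bounded_coefficients[OF K(1), of r "\<lambda>k j. wt k j - wt i j"] by blast
  define mu where "mu = Min (w ` K)"
  have mu: "mu > 0"
    unfolding mu_def using K w(2) by (subst Min_gr_iff) (auto simp: K_def)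
  have mu_le: "mu \<le> w k" if "k \<in> K" for k
    unfolding mu_def using that K by (intro Min_le) auto
  have w1: "w k \<le> 1" if "k \<in> K" for k
    using member_le_sum[OF that, of w] sumwK K w(2) by (force simp: K_def less_imp_le)
  \<comment> \<open>A weight will decrease by at most \<open>C * e * (card K + 1)\<close>, which
    must not exceed the least weight \<open>mu\<close>; the 1 added to \<open>C\<close> keeps the
    denominator positive.\<close>
  define e where "e = mu / ((C + 1) * (of_nat (card K) + 1))"
  have den: "(C + 1) * (of_nat (card K) + 1) > 0" using C(1) by (intro mult_pos_pos) auto
  have e: "e > 0" using mu den by (simp add: e_def)
  have "C * e * (of_nat (card K) + 1) \<le> (C + 1) * e * (of_nat (card K) + 1)"
    using e by (intro mult_right_mono) auto
  also have "\<dots> = mu" using den by (simp add: e_def field_simps)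
  finally have Ce: "C * e * (of_nat (card K) + 1) \<le> mu" .
  have "y \<in> F" if y: "y \<in> rat_affine hull F" "\<forall>j<r. \<bar>y $ j - wt i j\<bar> < e" for y
  proof -
    obtain d where d: "y = vec r (\<lambda>j. wt i j + (\<Sum>k\<in>K. d k * (wt k j - wt i j)))"
      using y(1) aff by (auto simp: A_def)
    have "\<forall>j<r. \<bar>\<Sum>k\<in>K. d k * (wt k j - wt i j)\<bar> \<le> e" using y(2) by (auto simp: d less_imp_le)
    then obtain d' where d': "\<forall>j<r. (\<Sum>k\<in>K. d' k * (wt k j - wt i j)) = (\<Sum>k\<in>K. d k * (wt k j - wt i j))"
      "\<forall>k\<in>K. \<bar>d' k\<bar> \<le> C * e" using C(2) e by (meson less_imp_le)
    \<comment> \<open>Subtracting \<open>w k * sum d' K\<close> restores total weight 1; as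
      \<open>w\<close> represents the \<open>i\<close>-th character, it also turns the differences
      into plain weights.\<close>
    define z where "z k = (if k \<in> K then w k + d' k - w k * sum d' K else 0)" for k
    have "\<bar>sum d' K\<bar> \<le> (\<Sum>k\<in>K. C * e)" using d'(2) by (intro order_trans[OF sum_abs] sum_mono) auto
    then have sd: "\<bar>sum d' K\<bar> \<le> of_nat (card K) * (C * e)" by simp
    have "0 \<le> z k" if k: "k \<in> K" for k
    proof -
      have "w k * sum d' K \<le> \<bar>w k * sum d' K\<bar>" by simp
      also have "\<dots> \<le> 1 * (of_nat (card K) * (C * e))"
        unfolding abs_mult using sd w1[OF k] mu mu_le[OF k] by (intro mult_mono) auto
      finally have "w k * sum d' K \<le> of_nat (card K) * (C * e)" by simp
      moreover have "- (C * e) \<le> d' k" using d'(2)[rule_format, OF k] by linarith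
      moreover have "mu \<le> w k" using mu_le[OF k] .
      ultimately show ?thesis using Ce k by (simp add: z_def algebra_simps)
    qed
    then have z0: "0 \<le> z k" for k by (cases "k \<in> K") (auto simp: z_def)
    have zK: "\<And>k. k < n \<Longrightarrow> k \<notin> K \<Longrightarrow> z k = 0" by (simp add: z_def)
    have sumz: "(\<Sum>k<n. z k * g k) = (1 - sum d' K) * (\<Sum>k\<in>K. w k * g k) + (\<Sum>k\<in>K. d' k * g k)" for g
    proof -
      have "(\<Sum>k<n. z k * g k) = (\<Sum>k\<in>K. (w k + d' k - w k * sum d' K) * g k)"
        by (subst restrict[of z, OF zK]) (auto simp: z_def)
      also have "(\<Sum>k\<in>K. (w k + d' k - w k * S) * g k) = (1 - S) * (\<Sum>k\<in>K. w k * g k) + (\<Sum>k\<in>K. d' k * g k)"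
        for S by (simp add: algebra_simps sum.distrib sum_subtractf sum_distrib_left)
      finally show ?thesis .
    qed
    have "sum z {..<n} = 1" using sumz[of "\<lambda>_. 1"] sumwK by simp
    then have cz: "convex_weights z" using z0 by (simp add: convex_weights_def)
    have "y = comb z"
    proof (rule eq_vecI)
      fix j assume "j < dim_vec (comb z)"
      then have j: "j < r" by simp
      have "y $ j = wt i j + (\<Sum>k\<in>K. d' k * (wt k j - wt i j))" using d' j by (simp add: d)
      also have "\<dots> = (1 - sum d' K) * wt i j + (\<Sum>k\<in>K. d' k * wt k j)"
        by (simp add: right_diff_distrib left_diff_distrib sum_subtractf sum_distrib_right)
      also have "\<dots> = comb z $ j" using j sumz[of "\<lambda>k. wt k j"] wt_i[OF j] by simp
      finally show "y $ j = comb z $ j" .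
    qed (simp add: d)
    then show ?thesis using inF[OF cz] zK by simp
  qed
  moreover have "vec r (wt i) \<in> F" using inF[OF w(1)] w(3) wK by simp
  ultimately show ?thesis
    using e i unfolding rat_rel_interior_def by (auto simp: rat_point_chi)
qed

text \<open>Two characters with the same minimal face both lie in its relative interior. This is the
  form in which the condition on faces is used afterwards.\<close>

lemma in_minimal_face_antisym:
  assumes one: "\<And>F. is_face r (weight_polytope n chi) F \<Longrightarrow>
      card {i. i < n \<and> rat_point (chi i) \<in> rat_rel_interior F} \<le> 1"
    and ij: "i < n" "j < n" "in_minimal_face i j" "in_minimal_face j i"
  shows "i = j"
proof -
  obtain u where u: "u \<in> functionals" "\<forall>l<n. u l \<le> u i" "\<And>l. l < n \<Longrightarrow> u l = u i \<longleftrightarrow> in_minimal_face l i"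
    using minimal_face_functional by blast
  then obtain c a where ca: "u = (\<lambda>l. c + (\<Sum>j<r. a j * wt l j))" unfolding functionals_def by blast
  define F where "F = {p \<in> weight_polytope n chi. vec r a \<bullet> p = u i - c}"
  have same: "in_minimal_face l i \<longleftrightarrow> in_minimal_face l j" for l using in_minimal_face_trans ij by blast
  have "rat_point (chi i) \<in> rat_rel_interior F"
    unfolding F_def using u by (intro in_rel_interior_of_minimal_face[OF ij(1) ca]) auto
  moreover have "rat_point (chi j) \<in> rat_rel_interior F"
    unfolding F_def using u same by (intro in_rel_interior_of_minimal_face[OF ij(2) ca]) auto
  ultimately have sub: "{i, j} \<subseteq> {i. i < n \<and> rat_point (chi i) \<in> rat_rel_interior F}"
    using ij by blast
  have "vec r a \<bullet> p \<le> u i - c" if p: "p \<in> weight_polytope n chi" for p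
  proof -
    obtain w where w: "p = comb w" "convex_weights w" using p unfolding weight_polytope_eq by blast
    have "(\<Sum>k<n. w k * u k) \<le> (\<Sum>k<n. w k * u i)"
      using u(2) w(2) by (intro sum_mono mult_left_mono) (auto simp: convex_weights_def)
    also have "\<dots> = u i" using w(2) by (simp add: convex_weights_def flip: sum_distrib_right)
    finally show ?thesis using scalar_prod_comb[OF w(2) ca] w(1) by simp
  qed
  then have "is_face r (weight_polytope n chi) F"
    unfolding is_face_def F_def by (intro bexI[of _ "vec r a"] exI[of _ "u i - c"]) auto
  from one[OF this] have "card {i, j} \<le> 1" using card_mono[OF _ sub] by fastforce
  then show ?thesis by (cases "i = j") auto
qed

text \<open>Pushing a relatively interior character slightly away from another one stays in the polytope;
  clearing denominators turns this into a relation between characters.\<close>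

lemma relation_if_rel_interior:
  assumes face: "is_face r (weight_polytope n chi) F"
    and ij: "i < n" "j < n" "i \<noteq> j"
      "rat_point (chi i) \<in> rat_rel_interior F" "rat_point (chi j) \<in> rat_rel_interior F"
  obtains N :: nat and c :: "nat \<Rightarrow> nat" where "N > 0" "sum c {..<n} = N" "c j > 0"
    "\<And>k. k < r \<Longrightarrow> of_nat N * chi i $ k = (\<Sum>l<n. of_nat (c l) * chi l $ k)"
proof -
  have inF: "vec r (wt i) \<in> F" "vec r (wt j) \<in> F"
    using ij by (auto simp: rat_rel_interior_def rat_point_chi)
  obtain e where e: "e > 0"
    "\<And>y. y \<in> rat_affine hull F \<Longrightarrow> \<forall>k<r. \<bar>y $ k - wt i k\<bar> < e \<Longrightarrow> y \<in> F"
    using ij by (auto simp: rat_rel_interior_def rat_point_chi)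
  define B where "B = (\<Sum>k<r. \<bar>wt i k - wt j k\<bar>)"
  have B: "B \<ge> 0" by (auto simp: B_def intro: sum_nonneg)
  \<comment> \<open>Small enough to stay within \<open>e\<close> in every coordinate; the 1 covers
    \<open>B = 0\<close>.\<close>
  define s where "s = e / (B + 1)"
  have s: "s > 0" using e B by (simp add: s_def)
  define y where "y = (1 + s) \<cdot>\<^sub>v vec r (wt i) + (- s) \<cdot>\<^sub>v vec r (wt j)"
  have "vec r (wt i) \<in> rat_affine hull F" "vec r (wt j) \<in> rat_affine hull F"
    using inF by (auto intro: hull_inc)
  then have "y \<in> rat_affine hull F"
    using rat_affine_hull[of F] unfolding rat_affine_def y_def by simp
  moreover have "\<bar>y $ k - wt i k\<bar> < e" if k: "k < r" for k
  proof -
    have "y $ k - wt i k = s * (wt i k - wt j k)" using k by (simp add: y_def algebra_simps)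
    then have "\<bar>y $ k - wt i k\<bar> = s * \<bar>wt i k - wt j k\<bar>" using s by (simp add: abs_mult)
    also have "\<dots> \<le> s * B" unfolding B_def using s k by (intro mult_left_mono member_le_sum) auto
    also have "\<dots> < s * (B + 1)" using s by simp
    also have "\<dots> = e" using B by (simp add: s_def)
    finally show ?thesis .
  qed
  ultimately have "y \<in> F" using e(2) by blast
  then have "y \<in> weight_polytope n chi" using face by (auto simp: is_face_def)
  then obtain w where w: "convex_weights w" "y = comb w" by (auto simp: weight_polytope_eq)
  \<comment> \<open>Solving \<open>y = (1 + s) chi_i - s chi_j\<close> for \<open>chi_i\<close>,
    with \<open>y\<close> expanded by \<open>w\<close>, gives convex weights that are positive at
    \<open>j\<close>.\<close>
  define v where "v l = (w l + s * of_bool (l = j)) / (1 + s)" for l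
  have sumv: "(1 + s) * (\<Sum>l<n. v l * g l) = (\<Sum>l<n. w l * g l) + s * g j" for g
  proof -
    have "(1 + s) * (\<Sum>l<n. v l * g l) = (\<Sum>l<n. w l * g l + s * (of_bool (l = j) * g l))"
      unfolding sum_distrib_left using s by (intro sum.cong) (auto simp: v_def field_simps)
    also have "\<dots> = (\<Sum>l<n. w l * g l) + s * (\<Sum>l<n. of_bool (l = j) * g l)"
      by (simp only: sum.distrib sum_distrib_left)
    finally show ?thesis using ij(2) by (simp only: sum_of_bool_mult)
  qed
  have v0: "0 \<le> v l" if "l < n" for l using w(1) s that by (simp add: v_def convex_weights_def)
  have vj: "v j > 0" using w(1) s ij(2) by (auto simp: v_def convex_weights_def add_nonneg_pos)
  have "(1 + s) * sum v {..<n} = 1 + s" using sumv[of "\<lambda>_. 1"] w(1) by (simp add: convex_weights_def)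
  then have v1: "sum v {..<n} = 1" using s by simp
  have vwt: "wt i k = (\<Sum>l<n. v l * wt l k)" if k: "k < r" for k
  proof -
    have "(\<Sum>l<n. w l * wt l k) = (1 + s) * wt i k - s * wt j k"
      using arg_cong[OF w(2), of "\<lambda>x. x $ k"] k by (simp add: y_def)
    then have "(1 + s) * (\<Sum>l<n. v l * wt l k) = (1 + s) * wt i k" using sumv[of "\<lambda>l. wt l k"] by simp
    then show ?thesis using s by simp
  qed
  obtain N :: nat and b :: "nat \<Rightarrow> int" where N: "N > 0"
    and b: "\<And>l. l \<in> {..<n} \<Longrightarrow> of_nat N * v l = of_int (b l)"
    using common_denominator[of "{..<n}" v] by auto
  define c where "c l = nat (b l)" for l
  have c: "of_nat N * v l = of_nat (c l)" if "l < n" for l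
  proof -
    have "(0 :: rat) \<le> of_nat N * v l" using v0[OF that] by simp
    then have "0 \<le> b l" unfolding b[of l, unfolded lessThan_iff, OF that] by simp
    then show ?thesis using b[of l] that by (simp add: c_def)
  qed
  show ?thesis
  proof
    show "N > 0" by fact
    have "(of_nat (sum c {..<n}) :: rat) = of_nat N * sum v {..<n}"
      unfolding sum_distrib_left of_nat_sum by (intro sum.cong) (use c in auto)
    then have "(of_nat (sum c {..<n}) :: rat) = of_nat N" by (simp only: v1 mult_1_right)
    then show "sum c {..<n} = N" by (simp only: of_nat_eq_iff)
    have "(0 :: rat) < of_nat N * v j" using vj N by simp
    then show "c j > 0" unfolding c[OF ij(2)] by simp
    show "of_nat N * chi i $ k = (\<Sum>l<n. of_nat (c l) * chi l $ k)" if k: "k < r" for k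
    proof -
      have "(of_int (of_nat N * chi i $ k) :: rat) = of_nat N * (\<Sum>l<n. v l * wt l k)"
        using vwt[OF k] by (simp add: wt_def)
      also have "\<dots> = (\<Sum>l<n. of_nat (c l) * wt l k)"
        unfolding sum_distrib_left by (intro sum.cong) (use c in \<open>auto simp flip: mult.assoc\<close>)
      also have "\<dots> = of_int (\<Sum>l<n. of_nat (c l) * chi l $ k)" by (simp add: wt_def)
      finally show ?thesis by (simp only: of_int_eq_iff)
    qed
  qed
qed

end

section \<open>Laurent polynomials on the torus and their initial forms\<close>

text \<open>If there were no root other than 0, the factorization into linear factors would be a
  monomial.\<close>

lemma poly_has_nonzero_root:
  fixes p :: "'k::alg_closed_field poly"
  assumes "coeff p i \<noteq> 0" "coeff p j \<noteq> 0" "i \<noteq> j"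
  shows "\<exists>x. x \<noteq> 0 \<and> poly p x = 0"
proof (rule ccontr)
  assume no: "\<not> ?thesis"
  have "p \<noteq> 0" using assms(1) by auto
  then obtain A where A: "size A = degree p" "p = Polynomial.smult (lead_coeff p) (\<Prod>x\<in>#A. [:-x, 1:])"
    using alg_closed_imp_factorization by blast
  have "x = 0" if "x \<in># A" for x
  proof -
    have "poly p x = 0" by (subst A(2)) (use that in \<open>auto simp: poly_prod_mset\<close>)
    then show ?thesis using no by blast
  qed
  then have "(\<Prod>x\<in>#A. [:-x, 1:]) = (\<Prod>x\<in>#A. [:0, 1:])"
    by (intro arg_cong[where f = prod_mset] image_mset_cong) simp
  also have "\<dots> = monom 1 (degree p)" using A(1) by (simp add: image_mset_const_eq monom_altdef)
  finally have "p = monom (lead_coeff p) (degree p)" using A(2) by (simp add: smult_monom)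
  then have "coeff p k = 0" if "k \<noteq> degree p" for k
    using that by (metis coeff_monom)
  then show False using assms by metis
qed

context weights
begin

text \<open>The pairing of one-parameter subgroups, given by their exponents, with
  characters.\<close>

definition pairing :: "(nat \<Rightarrow> int) \<Rightarrow> nat \<Rightarrow> int" where
  "pairing u i = (\<Sum>j<r. u j * chi i $ j)"

text \<open>For \<open>B\<close> the support of a Laurent polynomial, these are the terms of its
  initial form in direction \<open>u\<close>.\<close>

definition tops :: "(nat \<Rightarrow> rat) \<Rightarrow> nat set \<Rightarrow> nat set" where
  "tops u B = {i \<in> B. \<forall>l\<in>B. u l \<le> u i}"

lemma tops_subset: "tops u B \<subseteq> B" by (auto simp: tops_def)

lemma tops_nonempty:
  assumes "finite B" "B \<noteq> {}"
  shows "tops u B \<noteq> {}"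
proof -
  obtain i where "i \<in> B" "\<not> (\<exists>l\<in>B. u i < u l)"
    using finite_has_maximal[of "u ` B"] assms by (metis (no_types, lifting) arg_min_if_finite finite_imageI image_iff image_is_empty less_le)
  then show ?thesis by (auto simp: tops_def not_less)
qed

text \<open>Only integral directions define one-parameter subgroups; clearing denominators preserves
  the order of the values and hence all maxima.\<close>

lemma integral_direction:
  assumes "u \<in> functionals"
  obtains u' c and D :: rat where "D > 0" "\<And>i. of_int (pairing u' i) = D * (u i - c)"
proof -
  obtain c w where u: "u = (\<lambda>i. c + (\<Sum>j<r. w j * wt i j))"
    using assms unfolding functionals_def by blast
  obtain N :: nat and b where N: "N > 0" and b: "\<And>j. j \<in> {..<r} \<Longrightarrow> of_nat N * w j = of_int (b j)"
    using common_denominator[of "{..<r}" w] by auto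
  have "of_int (pairing b i) = of_nat N * (u i - c)" for i
  proof -
    have "(of_int (pairing b i) :: rat) = (\<Sum>j<r. of_int (b j) * wt i j)"
      by (simp add: pairing_def wt_def)
    also have "\<dots> = (\<Sum>j<r. of_nat N * (w j * wt i j))"
      by (intro sum.cong refl) (simp add: b flip: mult.assoc)
    finally show ?thesis by (simp add: u sum_distrib_left)
  qed
  then show ?thesis using that[of "of_nat N" b c] N by simp
qed

lemma tops_integral_direction:
  fixes D :: rat
  assumes "D > 0" "\<And>i. of_int (pairing u' i) = D * (u i - c)"
  shows "u l \<le> u i \<longleftrightarrow> pairing u' l \<le> pairing u' i"
proof -
  have "D * (u l - c) \<le> D * (u i - c) \<longleftrightarrow> pairing u' l \<le> pairing u' i"
    unfolding assms(2)[symmetric] by (rule of_int_le_iff)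
  then show ?thesis using mult_le_cancel_left_pos[OF assms(1), of "u l - c" "u i - c"] by simp
qed

lemma pairing_functional: "(\<lambda>i. of_int (pairing w i)) \<in> functionals"
  using functionals_dot[of "\<lambda>j. of_int (w j)"] by (simp add: pairing_def wt_def)

text \<open>A base that is not a root of any of the difference polynomials separates the characters.\<close>

lemma separating_direction:
  assumes inj: "inj_on chi {..<n}"
  obtains w where "inj_on (pairing w) {..<n}"
proof -
  define p where "p i l = (\<Sum>j<r. monom (chi i $ j - chi l $ j) j)" for i l
  define A where "A = {(i, l). i < n \<and> l < n \<and> i \<noteq> l}"
  have finA: "finite A" by (rule finite_subset[of _ "{..<n} \<times> {..<n}"]) (auto simp: A_def)
  have p0: "p i l \<noteq> 0" if "(i, l) \<in> A" for i l
  proof -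
    have il: "i < n" "l < n" "i \<noteq> l" using that by (auto simp: A_def)
    then have "chi i \<noteq> chi l" using inj by (auto simp: inj_on_def)
    moreover have "dim_vec (chi i) = r" "dim_vec (chi l) = r" using chi il by auto
    ultimately obtain j where j: "j < r" "chi i $ j \<noteq> chi l $ j" by (metis eq_vecI)
    have "coeff (p i l) j = (\<Sum>k<r. if k = j then chi i $ k - chi l $ k else 0)"
      by (simp add: p_def coeff_sum)
    also have "\<dots> = chi i $ j - chi l $ j" using j by simp
    finally show ?thesis using j by auto
  qed
  define R where "R = (\<Union>(i, l)\<in>A. {x. poly (p i l) x = 0})"
  have "finite R" unfolding R_def using finA p0 by (intro finite_UN_I) (auto intro: poly_roots_finite)
  then obtain M where M: "M \<notin> R" using infinite_UNIV_int ex_new_if_finite by blast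
  have "inj_on (pairing (\<lambda>j. M ^ j)) {..<n}"
  proof (rule inj_onI)
    fix i l assume il: "i \<in> {..<n}" "l \<in> {..<n}" "pairing (\<lambda>j. M ^ j) i = pairing (\<lambda>j. M ^ j) l"
    have "poly (p i l) M = pairing (\<lambda>j. M ^ j) i - pairing (\<lambda>j. M ^ j) l"
      by (simp add: p_def poly_sum poly_monom pairing_def algebra_simps sum_subtractf)
    then have "poly (p i l) M = 0" using il by simp
    then show "i = l" using M il by (force simp: R_def A_def)
  qed
  then show ?thesis by (rule that)
qed

definition shift :: "'k::field vec \<Rightarrow> 'k \<Rightarrow> (nat \<Rightarrow> int) \<Rightarrow> 'k vec" where
  "shift t s u = vec r (\<lambda>j. t $ j * s powi (u j))"

lemma shift_torus: "t \<in> torus r \<Longrightarrow> s \<noteq> 0 \<Longrightarrow> shift t s u \<in> torus r"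
  by (auto simp: torus_def shift_def)

lemma prod_powi: "finite A \<Longrightarrow> s \<noteq> 0 \<Longrightarrow> (\<Prod>j\<in>A. s powi f j) = (s::'k::field) powi (\<Sum>j\<in>A. f j)"
  by (induction A rule: finite_induct) (auto simp: power_int_add)

lemma character_shift:
  fixes s :: "'k::field"
  assumes "i < n" "s \<noteq> 0"
  shows "character (chi i) (shift t s u) = character (chi i) t * s powi (pairing u i)"
proof -
  have "character (chi i) (shift t s u)
      = (\<Prod>j<r. (t $ j) powi (chi i $ j) * s powi (u j * chi i $ j))"
    using chi[OF assms(1)] by (simp add: character_def shift_def power_int_mult_distrib power_int_mult)
  also have "\<dots> = character (chi i) t * s powi (pairing u i)"
    using chi[OF assms(1)] assms(2) by (simp add: character_def pairing_def prod.distrib prod_powi)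
  finally show ?thesis .
qed

lemma character_nonzero: "i < n \<Longrightarrow> t \<in> torus r \<Longrightarrow> character (chi i) t \<noteq> 0"
  using chi[of i] by (auto simp: character_def torus_def)

definition value_at :: "(nat \<Rightarrow> 'k::field) \<Rightarrow> 'k vec \<Rightarrow> 'k" where
  "value_at a t = (\<Sum>i<n. a i * character (chi i) t)"

definition zeros :: "(nat \<Rightarrow> 'k::field) \<Rightarrow> 'k vec set" where
  "zeros a = {t \<in> torus r. value_at a t = 0}"

definition restr :: "nat set \<Rightarrow> (nat \<Rightarrow> 'k::field) \<Rightarrow> nat \<Rightarrow> 'k" where
  "restr B a = (\<lambda>i. if i \<in> B then a i else 0)"

definition support :: "(nat \<Rightarrow> 'k::field) \<Rightarrow> nat set" where
  "support a = {i. i < n \<and> a i \<noteq> 0}"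

lemma finite_support [simp]: "finite (support a)" by (simp add: support_def)

lemma support_restr: "support (restr B a) = support a \<inter> B"
  by (auto simp: support_def restr_def)

lemma value_at_support: "value_at a t = (\<Sum>i\<in>support a. a i * character (chi i) t)"
  unfolding value_at_def by (rule sum.mono_neutral_right) (auto simp: support_def)

lemma value_at_restr:
  assumes "support a \<inter> B = C" "C \<subseteq> {..<n}"
  shows "value_at (restr B a) t = (\<Sum>i\<in>C. a i * character (chi i) t)"
  unfolding value_at_support support_restr assms(1)
  by (intro sum.cong) (use assms in \<open>auto simp: restr_def\<close>)

lemma one_torus: "vec r (\<lambda>_. 1) \<in> torus r" by (simp add: torus_def)

lemma zeros_singleton: "support a = {i} \<Longrightarrow> zeros a = {}"
  using character_nonzero[of i] by (auto simp: zeros_def value_at_support support_def)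

text \<open>Restriction of the Laurent polynomial \<open>a\<close> to the coset of a separating one-parameter subgroup,
  multiplied by a monomial.\<close>

lemma restriction_to_one_parameter_subgroup:
  fixes a :: "nat \<Rightarrow> 'k::field"
  assumes w: "inj_on (pairing w) {..<n}" and t: "t \<in> torus r"
  obtains p e where "\<And>s. s \<noteq> 0 \<Longrightarrow> poly p s = 0 \<longleftrightarrow> shift t s w \<in> zeros a"
    "\<And>i. i \<in> support a \<Longrightarrow> coeff p (e i) \<noteq> 0" "inj_on e (support a)"
proof -
  \<comment> \<open>Adding \<open>W\<close> turns all exponents into natural numbers.\<close>
  define W where "W = (\<Sum>i<n. \<bar>pairing w i\<bar>)"
  have W: "pairing w i + W \<ge> 0" if "i < n" for i
    using member_le_sum[of i "{..<n}" "\<lambda>i. \<bar>pairing w i\<bar>"] that by (simp add: W_def)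
  define e where "e i = nat (pairing w i + W)" for i
  define p where "p = (\<Sum>i\<in>support a. monom (a i * character (chi i) t) (e i))"
  have inj: "inj_on e (support a)"
  proof (rule inj_onI)
    fix i l assume "i \<in> support a" "l \<in> support a" "e i = e l"
    then show "i = l" using W[of i] W[of l] w by (auto simp: e_def inj_on_def support_def)
  qed
  have "poly p s = s powi W * value_at a (shift t s w)" if s: "s \<noteq> 0" for s
  proof -
    have "s ^ e i = s powi W * s powi (pairing w i)" if "i \<in> support a" for i
    proof -
      have "s ^ e i = s powi (W + pairing w i)"
        using W[of i] that by (simp add: e_def power_int_nonneg_exp support_def add.commute)
      then show ?thesis using s by (simp add: power_int_add)
    qed
    then show ?thesis unfolding value_at_support p_def sum_distrib_left poly_sum
      using s by (intro sum.cong) (auto simp: poly_monom character_shift support_def)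
  qed
  moreover have "coeff p (e i) \<noteq> 0" if i: "i \<in> support a" for i
  proof -
    have "coeff p (e i) = (\<Sum>l\<in>support a. if l = i then a l * character (chi l) t else 0)"
      unfolding p_def coeff_sum using inj i by (intro sum.cong) (auto simp: inj_on_def)
    also have "\<dots> = a i * character (chi i) t" using i by simp
    finally show ?thesis using i t character_nonzero[of i] by (auto simp: support_def)
  qed
  ultimately show ?thesis using inj shift_torus[OF t] by (intro that[of p e]) (simp_all add: zeros_def)
qed

text \<open>On a separating one-parameter subgroup distinct terms keep distinct exponents, so two
  terms leave a polynomial with two nonzero coefficients.\<close>

lemma zeros_nonempty:
  fixes a :: "nat \<Rightarrow> 'k::alg_closed_field"
  assumes "inj_on chi {..<n}" "i \<in> support a" "j \<in> support a" "i \<noteq> j"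
  shows "zeros a \<noteq> {}"
proof -
  obtain w where w: "inj_on (pairing w) {..<n}" using separating_direction assms(1) by blast
  obtain p e where p: "\<And>s. s \<noteq> 0 \<Longrightarrow> poly p s = 0 \<longleftrightarrow> shift (vec r (\<lambda>_. 1)) s w \<in> zeros a"
    "\<And>i. i \<in> support a \<Longrightarrow> coeff p (e i) \<noteq> 0" "inj_on e (support a)"
    by (rule restriction_to_one_parameter_subgroup[OF w one_torus]) (rule that; assumption)
  have "e i \<noteq> e j" using p(3) assms by (auto simp: inj_on_def)
  then obtain x where "x \<noteq> 0" "poly p x = 0"
    using poly_has_nonzero_root[OF p(2)[OF assms(2)] p(2)[OF assms(3)]] by blast
  then show ?thesis using p(1) by blast
qed

lemma zeros_ne_torus:
  fixes a :: "nat \<Rightarrow> 'k::alg_closed_field"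
  assumes "inj_on chi {..<n}" "support a \<noteq> {}"
  shows "\<exists>t\<in>torus r. t \<notin> zeros a"
proof -
  obtain w where w: "inj_on (pairing w) {..<n}" using separating_direction assms(1) by blast
  obtain p e where p: "\<And>s. s \<noteq> 0 \<Longrightarrow> poly p s = 0 \<longleftrightarrow> shift (vec r (\<lambda>_. 1)) s w \<in> zeros a"
    "\<And>i. i \<in> support a \<Longrightarrow> coeff p (e i) \<noteq> 0" "inj_on e (support a)"
    by (rule restriction_to_one_parameter_subgroup[OF w one_torus]) (rule that; assumption)
  obtain i where "i \<in> support a" using assms(2) by blast
  then have "p \<noteq> 0" using p(2)[of i] by auto
  have "\<exists>s. s \<noteq> 0 \<and> poly p s \<noteq> 0"
  proof (rule ccontr)
    assume "\<not> (\<exists>s. s \<noteq> 0 \<and> poly p s \<noteq> 0)"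
    then have "poly p s = 0" if "s \<notin> {0}" for s using that by blast
    then show False using poly_eq_0_if_zero_off_0[of "{0}" p] \<open>p \<noteq> 0\<close> by simp
  qed
  then obtain s where s: "s \<noteq> 0" "poly p s \<noteq> 0" by blast
  show ?thesis using p(1)[OF s(1)] s(2) shift_torus[OF one_torus s(1)] by (intro bexI[of _ "shift (vec r (\<lambda>_. 1)) s w"]) simp_all
qed

lemma zeros_empty_support: "support a = {} \<Longrightarrow> zeros a = torus r"
  by (auto simp: zeros_def value_at_support)

lemma support_empty_iff:
  fixes a b :: "nat \<Rightarrow> 'k::alg_closed_field"
  assumes "inj_on chi {..<n}" "zeros a = zeros b"
  shows "support a = {} \<longleftrightarrow> support b = {}"
proof -
  have "support x = {} \<longleftrightarrow> zeros x = torus r" for x :: "nat \<Rightarrow> 'k"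
    using zeros_empty_support zeros_ne_torus[OF assms(1), of x] by blast
  then show ?thesis using assms(2) by blast
qed

text \<open>The two-parameter family through \<open>t\<close> whose limit at parameter 0 is the initial form in
  direction \<open>u\<close>.\<close>

lemma initial_form_family:
  fixes a :: "nat \<Rightarrow> 'k::field"
  assumes w: "inj_on (pairing w) {..<n}" and t: "t \<in> torus r"
  obtains F where
    "\<And>e s. e \<noteq> 0 \<Longrightarrow> s \<noteq> 0 \<Longrightarrow>
        poly (specialize e F) s = 0 \<longleftrightarrow> shift (shift t e (\<lambda>j. - u j)) s w \<in> zeros a"
    "poly (specialize 0 F) 1 = 0 \<longleftrightarrow>
        t \<in> zeros (restr (tops (\<lambda>i. of_int (pairing u i)) (support a)) a)"
    "support a \<noteq> {} \<Longrightarrow> specialize 0 F \<noteq> 0"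
proof -
  define T where "T = tops (\<lambda>i. of_int (pairing u i)) (support a)"
  define W where "W = (\<Sum>i<n. \<bar>pairing w i\<bar>)"
  have W: "pairing w i + W \<ge> 0" if "i < n" for i
    using member_le_sum[of i "{..<n}" "\<lambda>i. \<bar>pairing w i\<bar>"] that by (simp add: W_def)
  define M where "M = Max (pairing u ` support a)"
  have M: "pairing u i \<le> M" if "i \<in> support a" for i unfolding M_def using that by simp
  have T: "i \<in> T \<longleftrightarrow> pairing u i = M" if i: "i \<in> support a" for i
  proof
    assume "i \<in> T"
    moreover have "M \<in> pairing u ` support a" unfolding M_def using i by (intro Max_in) auto
    ultimately show "pairing u i = M" using M[OF i] by (auto simp: T_def tops_def)
  next
    assume "pairing u i = M"
    then show "i \<in> T" using M i by (auto simp: T_def tops_def)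
  qed
  \<comment> \<open>The defect from the maximal pairing: exactly the top terms get exponent 0 and
    survive at parameter 0. This is why the family runs in the negated direction.\<close>
  define d where "d i = nat (M - pairing u i)" for i
  define e where "e i = nat (pairing w i + W)" for i
  \<comment> \<open>The outer variable follows the separating direction \<open>w\<close>, so
    surviving terms cannot cancel and \<open>F\<close> stays nonzero at parameter 0.\<close>
  define F where "F = (\<Sum>i\<in>support a. monom (monom (a i * character (chi i) t) (d i)) (e i))"
  have d0: "d i = 0 \<longleftrightarrow> i \<in> T" if "i \<in> support a" for i
    using M[OF that] T[OF that] by (auto simp: d_def)
  have inj: "inj_on e (support a)"
  proof (rule inj_onI)
    fix i l assume "i \<in> support a" "l \<in> support a" "e i = e l"
    then show "i = l" using W[of i] W[of l] w by (auto simp: e_def inj_on_def support_def)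
  qed
  have TS: "T \<subseteq> support a" by (simp add: T_def tops_subset)
  have ev: "poly (specialize z F) s = (\<Sum>i\<in>support a. a i * character (chi i) t * z ^ d i * s ^ e i)" for z s
    by (simp add: F_def specialize_sum specialize_monom poly_sum poly_monom)
  have "poly (specialize z F) s = z powi M * s powi W * value_at a (shift (shift t z (\<lambda>j. - u j)) s w)"
    if zs: "z \<noteq> 0" "s \<noteq> 0" for z s
  proof -
    have "z ^ d i * s ^ e i = z powi M * z powi (pairing (\<lambda>j. - u j) i) * (s powi W * s powi (pairing w i))"
      if "i \<in> support a" for i
    proof -
      have "s ^ e i = s powi (W + pairing w i)"
        using W[of i] that by (simp add: e_def power_int_nonneg_exp support_def add.commute)
      moreover have "z ^ d i = z powi (M + pairing (\<lambda>j. - u j) i)"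
        using M[OF that] by (simp add: d_def power_int_nonneg_exp pairing_def sum_negf)
      ultimately show ?thesis using zs by (simp add: power_int_add)
    qed
    then show ?thesis unfolding ev value_at_support sum_distrib_left
      using zs by (intro sum.cong refl) (simp add: character_shift support_def mult.assoc mult.left_commute)
  qed
  moreover have "poly (specialize 0 F) 1 = value_at (restr T a) t"
  proof -
    have "poly (specialize 0 F) 1 = (\<Sum>i\<in>support a. if i \<in> T then a i * character (chi i) t else 0)"
      unfolding ev using d0 by (intro sum.cong) (auto simp: power_0_left)
    also have "\<dots> = (\<Sum>i\<in>T. a i * character (chi i) t)"
      using TS by (simp add: sum.If_cases Int_absorb1)
    also have "\<dots> = value_at (restr T a) t"
      using TS by (subst value_at_restr[of a T T]) (auto simp: support_def)
    finally show ?thesis .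
  qed
  moreover have "specialize 0 F \<noteq> 0" if ne: "support a \<noteq> {}"
  proof -
    obtain i where i: "i \<in> T" using tops_nonempty[OF finite_support ne] unfolding T_def by blast
    then have iS: "i \<in> support a" using TS by blast
    have "coeff (specialize 0 F) (e i) = (\<Sum>l\<in>support a. if l = i then poly (monom (a l * character (chi l) t) (d l)) 0 else 0)"
      unfolding F_def specialize_sum specialize_monom coeff_sum using inj iS
      by (intro sum.cong) (auto simp: inj_on_def)
    also have "\<dots> = a i * character (chi i) t" using iS d0[OF iS] i by (simp add: poly_monom)
    finally have "coeff (specialize 0 F) (e i) \<noteq> 0" using iS t character_nonzero[of i] by (auto simp: support_def)
    then show ?thesis by (metis coeff_0)
  qed
  ultimately show ?thesis
    using shift_torus[OF shift_torus[OF t]] t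
    by (intro that[of F]) (simp_all add: zeros_def T_def)
qed

text \<open>The families of \<open>a\<close> and \<open>b\<close> run through the same translates of
  \<open>t\<close>, so \<open>zero_inclusion_specializes\<close> applies to them.\<close>

lemma zeros_initial_form:
  fixes a b :: "nat \<Rightarrow> 'k::alg_closed_field"
  assumes inj: "inj_on chi {..<n}" and u: "u \<in> functionals"
    and sub: "zeros a \<subseteq> zeros b" and ne: "support a \<noteq> {}"
  shows "zeros (restr (tops u (support a)) a) \<subseteq> zeros (restr (tops u (support b)) b)"
proof
  fix t assume tz: "t \<in> zeros (restr (tops u (support a)) a)"
  then have t: "t \<in> torus r" by (simp add: zeros_def)
  obtain w where w: "inj_on (pairing w) {..<n}" using separating_direction inj by blast
  obtain u' c and D :: rat where u': "D > 0" "\<And>i. of_int (pairing u' i) = D * (u i - c)"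
    by (rule integral_direction[OF u]) (rule that; assumption)
  have tops: "tops (\<lambda>i. of_int (pairing u' i)) B = tops u B" for B
    using tops_integral_direction[OF u'] by (simp add: tops_def)
  obtain F where F: "\<And>e s. e \<noteq> 0 \<Longrightarrow> s \<noteq> 0 \<Longrightarrow>
        poly (specialize e F) s = 0 \<longleftrightarrow> shift (shift t e (\<lambda>j. - u' j)) s w \<in> zeros a"
    "poly (specialize 0 F) 1 = 0 \<longleftrightarrow> t \<in> zeros (restr (tops u (support a)) a)"
    "support a \<noteq> {} \<Longrightarrow> specialize 0 F \<noteq> 0"
    by (rule initial_form_family[OF w t, of u' a, unfolded tops]) (rule that; assumption)
  obtain H where H: "\<And>e s. e \<noteq> 0 \<Longrightarrow> s \<noteq> 0 \<Longrightarrow>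
        poly (specialize e H) s = 0 \<longleftrightarrow> shift (shift t e (\<lambda>j. - u' j)) s w \<in> zeros b"
    "poly (specialize 0 H) 1 = 0 \<longleftrightarrow> t \<in> zeros (restr (tops u (support b)) b)"
    by (rule initial_form_family[OF w t, of u' b, unfolded tops]) (rule that; assumption)
  have "poly (specialize 0 H) 1 = 0"
  proof (rule zero_inclusion_specializes[OF F(3)[OF ne]])
    show "poly (specialize 0 F) 1 = 0" using tz F(2) by simp
    show "poly (specialize e H) s = 0" if "e \<noteq> 0" "s \<noteq> 0" "poly (specialize e F) s = 0" for e s
      using F(1)[OF that(1,2)] H(1)[OF that(1,2)] that(3) sub by auto
  qed
  then show "t \<in> zeros (restr (tops u (support b)) b)" using H(2) by blast
qed

end

section \<open>Laurent polynomials with the same zeros on all faces\<close>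

text \<open>\<open>(v l - v k) / (w k - w l)\<close> is the parameter at which a faster
  \<open>k\<close> catches up with \<open>l\<close>; the least of these is the last at which
  \<open>l\<close> still dominates \<open>C\<close>.\<close>

lemma last_tie:
  fixes v w :: "'i \<Rightarrow> rat"
  assumes "finite C" "y \<in> C" "w l < w y" and beats: "\<And>k. k \<in> C \<Longrightarrow> v k + s * w k \<le> v l + s * w l"
  shows "\<exists>t\<ge>s. (\<forall>k\<in>C. v k + t * w k \<le> v l + t * w l) \<and>
    (\<exists>k\<in>C. w l < w k \<and> t = (v l - v k) / (w k - w l))"
proof -
  define A where "A = {k \<in> C. w l < w k}"
  define f where "f k = (v l - v k) / (w k - w l)" for k
  define t where "t = Min (f ` A)"
  have A: "finite A" "A \<noteq> {}" using assms by (auto simp: A_def)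
  have iff: "z \<le> f k \<longleftrightarrow> v k + z * w k \<le> v l + z * w l" if "k \<in> A" for k z
    using that by (simp add: A_def f_def le_divide_eq algebra_simps)
  have "t \<in> f ` A" unfolding t_def using A by (intro Min_in) auto
  then obtain k where k: "k \<in> A" "t = f k" by blast
  have tle: "t \<le> f k" if "k \<in> A" for k unfolding t_def using A that by (intro Min_le) auto
  have st: "s \<le> t" using iff[OF k(1)] k beats by (simp add: A_def)
  have "v k + t * w k \<le> v l + t * w l" if "k \<in> C" for k
  proof (cases "k \<in> A")
    case True
    then show ?thesis using iff tle by blast
  next
    case False
    then have "(t - s) * w k \<le> (t - s) * w l" using that st by (intro mult_left_mono) (auto simp: A_def)
    then show ?thesis using beats[OF that] by (simp add: algebra_simps)
  qed
  then show ?thesis using st k by (intro exI[of _ t]) (auto simp: A_def f_def)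
qed

text \<open>If the maximum of \<open>v\<close> is attained in \<open>C\<^sub>1\<close> and that of \<open>w\<close> only in \<open>C\<^sub>2\<close>, then some function on the
  ray from \<open>v\<close> in direction \<open>w\<close> attains its maximum in both sets: take the last parameter at which
  an element of \<open>C\<^sub>1\<close> dominates \<open>C\<^sub>2\<close>.\<close>

lemma maximum_in_both:
  fixes v w :: "'i \<Rightarrow> rat"
  assumes fin: "finite C1" "finite C2" and x: "x \<in> C1" "\<And>k. k \<in> C2 \<Longrightarrow> v k \<le> v x"
    and y: "y \<in> C2" "\<And>l. l \<in> C1 \<Longrightarrow> w l < w y"
  shows "\<exists>t\<ge>0. \<exists>l\<in>C1. \<exists>k\<in>C2. v l + t * w l = v k + t * w k \<and>
    (\<forall>j\<in>C1 \<union> C2. v j + t * w j \<le> v l + t * w l)"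
proof -
  \<comment> \<open>Parameters at which some element of \<open>C1\<close> dominates
    \<open>C2\<close> for the last time; each is determined by a pair, so there are finitely
    many.\<close>
  define E where "E = {t. 0 \<le> t \<and> (\<exists>l\<in>C1. (\<forall>k\<in>C2. v k + t * w k \<le> v l + t * w l) \<and>
    (\<exists>k\<in>C2. w l < w k \<and> t = (v l - v k) / (w k - w l)))}"
  have "E \<subseteq> (\<lambda>(l, k). (v l - v k) / (w k - w l)) ` (C1 \<times> C2)" by (auto simp: E_def)
  then have finE: "finite E" using fin by (meson finite_SigmaI finite_imageI finite_subset)
  have inE: "\<exists>t\<in>E. s \<le> t \<and> (\<exists>k\<in>C2. v k + t * w k = v l + t * w l)"
    if l: "l \<in> C1" "0 \<le> s" and beats: "\<And>k. k \<in> C2 \<Longrightarrow> v k + s * w k \<le> v l + s * w l" for l s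
  proof -
    obtain t k where t: "t \<ge> s" "\<forall>k\<in>C2. v k + t * w k \<le> v l + t * w l"
      "k \<in> C2" "w l < w k" "t = (v l - v k) / (w k - w l)"
      using last_tie[OF fin(2) y(1) y(2)[OF l(1)] beats] by blast
    have "t \<in> E" unfolding E_def using t l by auto
    moreover have "v k + t * w k = v l + t * w l" using t(4,5) by (simp add: field_simps)
    ultimately show ?thesis using t by blast
  qed
  obtain t0 where "t0 \<in> E" using inE[of x 0] x by auto
  define t where "t = Max E"
  have t: "t \<in> E" unfolding t_def using finE \<open>t0 \<in> E\<close> by (intro Max_in) auto
  obtain l k where l: "0 \<le> t" "l \<in> C1" "\<And>k. k \<in> C2 \<Longrightarrow> v k + t * w k \<le> v l + t * w l"
    and k: "k \<in> C2" "w l < w k" "t = (v l - v k) / (w k - w l)"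
    using t unfolding E_def by blast
  have tie: "v l + t * w l = v k + t * w k" using k(2,3) by (simp add: field_simps)
  \<comment> \<open>An element of \<open>C1\<close> above \<open>l\<close> would dominate
    \<open>C2\<close> strictly, so its own last tie would come after the maximum of
    \<open>E\<close>.\<close>
  have "v j + t * w j \<le> v l + t * w l" if j: "j \<in> C1" for j
  proof (rule ccontr)
    assume "\<not> ?thesis"
    then have gt: "v k + t * w k < v j + t * w j" if "k \<in> C2" for k using l(3)[OF that] by linarith
    obtain t' where t': "t' \<in> E" "t \<le> t'" "\<exists>k\<in>C2. v k + t' * w k = v j + t' * w j"
      using inE[OF j l(1)] gt by (meson less_imp_le)
    have "t' \<le> t" unfolding t_def using finE t'(1) by simp
    then have "t' = t" using t'(2) by simp
    then show False using t'(3) gt by (metis less_irrefl)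
  qed
  then show ?thesis using l k(1) tie by (intro exI[of _ t] conjI bexI[of _ l] bexI[of _ k]) auto
qed

locale separated_weights = weights +
  assumes antisym: "i < n \<Longrightarrow> j < n \<Longrightarrow> in_minimal_face i j \<Longrightarrow> in_minimal_face j i \<Longrightarrow> i = j"
begin

lemma eq_if_functionals_eq:
  assumes "i < n" "j < n" "\<And>u. u \<in> functionals \<Longrightarrow> u i = u j"
  shows "i = j"
  using assms(1,2) unfolding in_minimal_face_def
  by (intro antisym) (auto simp: in_minimal_face_def intro: assms(3) assms(3)[symmetric])

lemma inj_chi: "inj_on chi {..<n}"
proof (rule inj_onI)
  fix i j assume ij: "i \<in> {..<n}" "j \<in> {..<n}" "chi i = chi j"
  show "i = j"
    by (rule eq_if_functionals_eq) (use ij in \<open>auto simp: functionals_def wt_def\<close>)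
qed

text \<open>The faces are those of the polytope of all characters, not of the Newton polytopes, so a
  restriction may vanish identically and have the whole torus as zeros. This is what makes supports
  comparable.\<close>

definition same_on_faces :: "(nat \<Rightarrow> 'k::field) \<Rightarrow> (nat \<Rightarrow> 'k) \<Rightarrow> bool" where
  "same_on_faces a b \<longleftrightarrow>
     (\<forall>u\<in>functionals. zeros (restr (tops u {..<n}) a) = zeros (restr (tops u {..<n}) b))"

lemma restr_singleton_support: "support a \<inter> B = {i} \<Longrightarrow> zeros (restr B a) = {}"
  by (rule zeros_singleton) (simp add: support_restr)

lemma same_on_minimal_face:
  assumes "same_on_faces a b" "i < n"
  shows "zeros (restr {l. l < n \<and> in_minimal_face l i} a) = zeros (restr {l. l < n \<and> in_minimal_face l i} b)"
proof -
  obtain g where g: "g \<in> functionals" "\<forall>l<n. g l \<le> g i" "\<And>l. l < n \<Longrightarrow> g l = g i \<longleftrightarrow> in_minimal_face l i"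
    using minimal_face_functional by blast
  have "tops g {..<n} = {l. l < n \<and> in_minimal_face l i}"
    using g(2,3) assms(2) by (force simp: tops_def)
  then show ?thesis using assms(1) g(1) unfolding same_on_faces_def by metis
qed

text \<open>Otherwise take a minimal character violating this. On its minimal face it is the initial monomial
  of \<open>a\<close> in some direction, where then \<open>b\<close> also has a single initial monomial; tilting the direction
  until the two monomials tie gives an initial form with zeros for \<open>a\<close> but not for \<open>b\<close>.\<close>

lemma support_dominated:
  fixes a b :: "nat \<Rightarrow> 'k::alg_closed_field"
  assumes "same_on_faces a b" "i \<in> support a" "v \<in> functionals"
  shows "\<exists>l\<in>support b. in_minimal_face l i \<and> v i \<le> v l"
  using assms
proof (induction "card {l. l < n \<and> in_minimal_face l i}" arbitrary: i a b v rule: less_induct)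
  case less
  define G where "G = {l. l < n \<and> in_minimal_face l i}"
  have i: "i < n" "i \<in> G" using less.prems(2) by (auto simp: support_def G_def in_minimal_face_refl)
  have smaller: "card {l. l < n \<and> in_minimal_face l k} < card G" if k: "k \<in> G" "k \<noteq> i" for k
  proof (rule psubset_card_mono)
    have "i \<notin> {l. l < n \<and> in_minimal_face l k}" using antisym k i by (auto simp: G_def)
    moreover have "{l. l < n \<and> in_minimal_face l k} \<subseteq> G" using k in_minimal_face_trans by (auto simp: G_def)
    ultimately show "{l. l < n \<and> in_minimal_face l k} \<subset> G" using i by blast
  qed (simp add: G_def)
  have same: "same_on_faces a b" "same_on_faces b a"
    using less.prems(1) by (auto simp: same_on_faces_def)
  have IH: "\<exists>l\<in>support b. l \<in> G \<and> in_minimal_face l k \<and> u k \<le> u l"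
    if k: "k \<in> support a" "k \<in> G" "k \<noteq> i" and u: "u \<in> functionals" for k u
  proof -
    obtain l where "l \<in> support b" "in_minimal_face l k" "u k \<le> u l"
      using less.hyps[OF smaller[OF k(2,3), unfolded G_def] same(1) k(1) u] by blast
    then show ?thesis using k in_minimal_face_trans by (auto simp: G_def support_def)
  qed
  have IH': "\<exists>l\<in>support a. l \<in> G \<and> in_minimal_face l k \<and> u k \<le> u l"
    if k: "k \<in> support b" "k \<in> G" "k \<noteq> i" and u: "u \<in> functionals" for k u
  proof -
    obtain l where "l \<in> support a" "in_minimal_face l k" "u k \<le> u l"
      using less.hyps[OF smaller[OF k(2,3), unfolded G_def] same(2) k(1) u] by blast
    then show ?thesis using k in_minimal_face_trans by (auto simp: G_def support_def)
  qed
  define fa where "fa = restr G a"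
  define fb where "fb = restr G b"
  have sa: "support fa = support a \<inter> G" and sb: "support fb = support b \<inter> G"
    by (simp_all add: fa_def fb_def support_restr)
  have zz: "zeros fa = zeros fb"
    unfolding fa_def fb_def G_def by (rule same_on_minimal_face[OF less.prems(1) i(1)])
  have ia: "i \<in> support fa" using sa i less.prems(2) by simp
  then have nea: "support fa \<noteq> {}" by blast
  then have neb: "support fb \<noteq> {}" using support_empty_iff[OF inj_chi zz] by simp
  show ?case
  proof (rule ccontr)
    assume "\<not> ?case"
    then have b_lt: "v l < v i" if "l \<in> support fb" for l using that by (force simp: sb G_def)
    have a_lt: "v k < v i" if k: "k \<in> support fa" "k \<noteq> i" for k
    proof -
      obtain l where "l \<in> support b" "l \<in> G" "v k \<le> v l"
        using IH[of k v] k less.prems(3) by (auto simp: sa)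
      then show ?thesis using b_lt[of l] by (simp add: sb)
    qed
    have "tops v (support fa) = {i}"
      using a_lt ia by (force simp: tops_def less_le_not_le)
    then have "zeros (restr (tops v (support fa)) fa) = {}"
      using ia by (intro restr_singleton_support) auto
    then have zb: "zeros (restr (tops v (support fb)) fb) = {}"
      using zeros_initial_form[OF inj_chi less.prems(3) _ neb, of fa] zz by simp
    obtain w where w: "w \<in> tops v (support fb)" using tops_nonempty[OF finite_support neb] by blast
    then have wb: "w \<in> support fb" using tops_subset by blast
    have w_only: "v l < v w" if l: "l \<in> support fb" "l \<noteq> w" for l
    proof (rule ccontr)
      assume "\<not> v l < v w"
      then have "l \<in> tops v (support fb)" using w l by (fastforce simp: tops_def)
      then have "l \<in> support (restr (tops v (support fb)) fb)" "w \<in> support (restr (tops v (support fb)) fb)"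
        using w l wb by (auto simp: support_restr)
      from zeros_nonempty[OF inj_chi this l(2)] zb show False by simp
    qed
    have wi: "w \<noteq> i" using b_lt[OF wb] by auto
    have wG: "w \<in> G" "w \<in> support b" "w < n" using wb by (auto simp: sb G_def)
    have "\<not> in_minimal_face i w" using antisym wi wG i by (auto simp: G_def)
    then obtain p where p: "p \<in> functionals" "\<forall>l<n. p l \<le> p w" "p i \<noteq> p w"
      unfolding in_minimal_face_def by blast
    then have piw: "p i < p w" using i by (simp add: order_less_le)
    \<comment> \<open>Tilts \<open>v\<close> by \<open>p\<close>, which favours \<open>w\<close>
      over \<open>i\<close>, until both get the same value.\<close>
    define rho where "rho = (v i - v w) / (p w - p i)"
    have rho: "rho > 0" using b_lt[OF wb] piw by (simp add: rho_def)
    define q where "q = (\<lambda>l. v l + rho * p l)"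
    have q: "q \<in> functionals"
      unfolding q_def by (intro functionals_add functionals_scale less.prems(3) p(1))
    have "rho * (p w - p i) = v i - v w" using piw by (simp add: rho_def)
    then have qiw: "q i = q w" by (simp add: q_def algebra_simps)
    have q_lt: "q l < q w" if l: "l \<in> support fb" "l \<noteq> w" for l
    proof -
      have "l < n" using l by (simp add: support_def)
      then have "rho * p l \<le> rho * p w" using rho p(2) by simp
      then show ?thesis using w_only[OF l] by (simp add: q_def)
    qed
    then have "tops q (support fb) = {w}" using wb by (force simp: tops_def less_le_not_le)
    then have "zeros (restr (tops q (support fb)) fb) = {}"
      using wb by (intro restr_singleton_support) auto
    then have za: "zeros (restr (tops q (support fa)) fa) = {}"
      using zeros_initial_form[OF inj_chi q _ nea, of fb] zz by simp
    have q_le: "q k \<le> q i" if k: "k \<in> support fa" for k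
    proof (cases "k = i")
      case False
      then obtain l where l: "l \<in> support b" "l \<in> G" "q k \<le> q l"
        using IH[of k q] k q by (auto simp: sa)
      then have "q l \<le> q w" using q_lt[of l] by (cases "l = w") (auto simp: sb)
      then show ?thesis using l qiw by simp
    qed simp
    \<comment> \<open>The induction hypothesis with exchanged roles gives a term of \<open>a\<close>
      in the minimal face of \<open>w\<close>. It ties with \<open>i\<close> and differs from it, as
      \<open>i\<close> is not in that face.\<close>
    obtain l where l: "l \<in> support a" "l \<in> G" "in_minimal_face l w" "q w \<le> q l"
      using IH'[OF wG(2,1) wi q] by blast
    have li: "i \<noteq> l" using l(3) \<open>\<not> in_minimal_face i w\<close> by auto
    have la: "l \<in> support fa" using l by (simp add: sa)
    have "i \<in> tops q (support fa)" using q_le ia by (simp add: tops_def)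
    moreover have "l \<in> tops q (support fa)" using q_le la l(4) qiw by (force simp: tops_def)
    ultimately have "i \<in> support (restr (tops q (support fa)) fa)" "l \<in> support (restr (tops q (support fa)) fa)"
      using ia la by (auto simp: support_restr)
    from zeros_nonempty[OF inj_chi this li] za show False by simp
  qed
qed

text \<open>Inclusion of convex hulls, expressed by support functions; in both directions it says
  that two Newton polytopes agree.\<close>

definition dominated :: "nat set \<Rightarrow> nat set \<Rightarrow> bool" where
  "dominated S T \<longleftrightarrow> (\<forall>u\<in>functionals. \<forall>i\<in>S. \<exists>l\<in>T. u i \<le> u l)"

lemma dominatedD: "dominated S T \<Longrightarrow> u \<in> functionals \<Longrightarrow> i \<in> S \<Longrightarrow> \<exists>l\<in>T. u i \<le> u l"
  by (auto simp: dominated_def)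

text \<open>\<open>T\<close> cannot exceed the maximum over \<open>S\<close>, so the faces of both
  supports can be read off from their union.\<close>

lemma tops_Un_dominated:
  assumes "dominated T S" "v \<in> functionals"
  shows "tops v S = S \<inter> tops v (S \<union> T)"
proof
  show "tops v S \<subseteq> S \<inter> tops v (S \<union> T)"
  proof
    fix i assume i: "i \<in> tops v S"
    have "v l \<le> v i" if "l \<in> T" for l
      using dominatedD[OF assms(1,2) that] i by (force simp: tops_def)
    then show "i \<in> S \<inter> tops v (S \<union> T)" using i by (auto simp: tops_def)
  qed
qed (auto simp: tops_def)

text \<open>A large multiple of \<open>v\<close> forces the dominating element into the face cut out by \<open>v\<close>.\<close>

lemma dominated_tops:
  assumes ST: "dominated S T" and v: "v \<in> functionals" and fin: "finite T"
    and B: "B = tops v (S \<union> T)"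
  shows "dominated (S \<inter> B) (T \<inter> B)"
  unfolding dominated_def
proof (intro ballI)
  fix u i assume u: "u \<in> functionals" and i: "i \<in> S \<inter> B"
  have lt: "v l < v i" if "l \<in> T" "l \<notin> B" for l
    using that i unfolding B tops_def by force
  define N where "N = 1 + (\<Sum>l\<in>T - B. \<bar>u l - u i\<bar> / (v i - v l))"
  have "(\<lambda>l. u l + N * v l) \<in> functionals" by (intro functionals_add functionals_scale u v)
  from dominatedD[OF ST this] i obtain l where l: "l \<in> T" "u i + N * v i \<le> u l + N * v l" by blast
  have "l \<in> B"
  proof (rule ccontr)
    assume nB: "l \<notin> B"
    then have d: "0 < v i - v l" using lt l by simp
    have "\<bar>u l - u i\<bar> / (v i - v l) \<le> (\<Sum>l\<in>T - B. \<bar>u l - u i\<bar> / (v i - v l))"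
      using fin l nB lt by (intro member_le_sum[of l "T - B" "\<lambda>l. \<bar>u l - u i\<bar> / (v i - v l)"]) (auto intro!: divide_nonneg_pos)
    then have "\<bar>u l - u i\<bar> / (v i - v l) < N" by (simp add: N_def)
    then have "\<bar>u l - u i\<bar> < N * (v i - v l)" using d by (simp add: divide_less_eq)
    then have "u l - u i < N * (v i - v l)" by linarith
    then show False using l(2) by (simp add: algebra_simps)
  qed
  moreover have "v l = v i" using \<open>l \<in> B\<close> i l unfolding B tops_def by force
  ultimately show "\<exists>l\<in>T \<inter> B. u i \<le> u l" using l by auto
qed

section \<open>Ratios of coefficients on a common Newton polytope\<close>

lemma value_at_diff: "value_at (\<lambda>i. a i - c * b i) t = value_at a t - c * value_at b t"
  by (simp add: value_at_def sum_subtractf algebra_simps sum_distrib_left)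

lemma support_singleton_if_no_zeros:
  fixes a :: "nat \<Rightarrow> 'k::alg_closed_field"
  assumes "zeros a = {}" "support a \<noteq> {}"
  obtains i where "support a = {i}"
proof -
  obtain i where i: "i \<in> support a" using assms by blast
  have "support a = {i}" using zeros_nonempty[OF inj_chi i] i assms(1) by blast
  then show ?thesis by (rule that)
qed

lemma character_shift_one:
  assumes "i < n" "s \<noteq> 0"
  shows "character (chi i) (shift (vec r (\<lambda>_. 1)) s u) = s powi (pairing u i)"
proof -
  have "character (chi i) (vec r (\<lambda>_. 1)) = (1 :: 'a)" using chi[OF assms(1)] by (simp add: character_def)
  then show ?thesis using character_shift[OF assms] by simp
qed

text \<open>Both coefficient pairs are orthogonal to the same \<open>(X, Y)\<close> with nonzero
  entries.\<close>

lemma ratio_binomial: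
  fixes a b :: "nat \<Rightarrow> 'k::alg_closed_field"
  assumes "support a = {x, y}" "support b = {x, y}" "x \<noteq> y" "zeros a = zeros b"
  shows "a x * b y = b x * a y"
proof -
  obtain t where t: "t \<in> zeros a" using zeros_nonempty[OF inj_chi, of x a y] assms by blast
  define X Y where "X = character (chi x) t" and "Y = character (chi y) t"
  have xy: "x < n" "y < n" using assms(1) by (auto simp: support_def)
  then have nz: "X \<noteq> 0" "Y \<noteq> 0" using t character_nonzero by (auto simp: X_def Y_def zeros_def)
  have "a x * X + a y * Y = 0" "b x * X + b y * Y = 0"
    using t assms by (auto simp: zeros_def value_at_support X_def Y_def)
  then have e: "a x * X = - (a y * Y)" "b x * X = - (b y * Y)" by (simp_all add: eq_neg_iff_add_eq_0)
  have "(a x * b y) * (X * Y) = (a x * X) * (b y * Y)" by (simp add: mult_ac)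
  also have "\<dots> = (b x * X) * (a y * Y)" unfolding e by (simp add: mult_ac)
  also have "\<dots> = (b x * a y) * (X * Y)" by (simp add: mult_ac)
  finally show ?thesis using nz by simp
qed

text \<open>Restricted to the one-parameter subgroup of \<open>w\<close> and divided by the lowest
  power, both become univariate trinomials with the same nonzero roots.\<close>

lemma ratio_trinomial:
  fixes a b :: "nat \<Rightarrow> 'k::alg_closed_field"
  assumes supp: "support a \<subseteq> {x, m, y}" "support b \<subseteq> {x, m, y}" and lt: "x < n" "m < n" "y < n"
    and pr: "pairing w x < pairing w m" "pairing w m < pairing w y"
    and nz: "a x \<noteq> 0" "a y \<noteq> 0" "b x \<noteq> 0" "b y \<noteq> 0" and zz: "zeros a = zeros b"
  shows "a x * b y = b x * a y"
proof -
  define P where "P = nat (pairing w m - pairing w x)"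
  define Q where "Q = nat (pairing w y - pairing w x)"
  have PQ: "0 < P" "P < Q" using pr by (auto simp: P_def Q_def)
  have dist: "x \<noteq> m" "m \<noteq> y" "x \<noteq> y" using pr by auto
  have val: "shift (vec r (\<lambda>_. 1)) s w \<in> zeros f \<longleftrightarrow> f x + f m * s ^ P + f y * s ^ Q = 0"
    if s: "s \<noteq> 0" and f: "support f \<subseteq> {x, m, y}" for s and f :: "nat \<Rightarrow> 'k"
  proof -
    have "value_at f (shift (vec r (\<lambda>_. 1)) s w)
        = (\<Sum>i\<in>{x, m, y}. f i * character (chi i) (shift (vec r (\<lambda>_. 1)) s w))"
      unfolding value_at_def using lt f by (intro sum.mono_neutral_right) (auto simp: support_def)
    also have "\<dots> = (\<Sum>i\<in>{x, m, y}. f i * s powi (pairing w i))"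
      using lt s by (intro sum.cong refl) (auto simp: character_shift_one)
    also have "\<dots> = f x * s powi pairing w x + f m * s powi pairing w m + f y * s powi pairing w y"
      using dist by simp
    also have "s powi pairing w m = s powi pairing w x * s ^ P"
      using s pr by (simp add: P_def power_int_add[symmetric] flip: power_int_of_nat)
    also have "s powi pairing w y = s powi pairing w x * s ^ Q"
      using s pr by (simp add: Q_def power_int_add[symmetric] flip: power_int_of_nat)
    finally have "value_at f (shift (vec r (\<lambda>_. 1)) s w)
        = s powi pairing w x * (f x + f m * s ^ P + f y * s ^ Q)" by (simp add: algebra_simps)
    then show ?thesis using s shift_torus[OF one_torus s] by (simp add: zeros_def)
  qed
  show ?thesis
    by (rule trinomial_roots_determine_ratio[OF PQ nz(1,2,3,4), of "a m" "b m"])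
       (use val supp zz in blast)
qed

text \<open>Characters not lying on a proper face of the Newton polytope of \<open>U\<close> have the same minimal face,
  so there is at most one.\<close>

lemma interior_unique:
  assumes ij: "i \<in> U" "j \<in> U" and U: "U \<subseteq> {..<n}"
    and int: "\<And>v. v \<in> functionals \<Longrightarrow> i \<in> tops v U \<Longrightarrow> tops v U = U"
      "\<And>v. v \<in> functionals \<Longrightarrow> j \<in> tops v U \<Longrightarrow> tops v U = U"
  shows "i = j"
proof -
  have key: "in_minimal_face k l" if kl: "k \<in> U" "l \<in> U"
    and h: "\<And>v. v \<in> functionals \<Longrightarrow> l \<in> tops v U \<Longrightarrow> tops v U = U" for k l
    unfolding in_minimal_face_def
  proof (intro ballI impI)
    fix v assume v: "v \<in> functionals" "\<forall>k<n. v k \<le> v l"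
    then have "l \<in> tops v U" using kl U by (auto simp: tops_def)
    then have "k \<in> tops v U" using h[OF v(1)] kl by simp
    then have "v l \<le> v k" using kl by (simp add: tops_def)
    moreover have "v k \<le> v l" using v(2) kl U by auto
    ultimately show "v k = v l" by simp
  qed
  show ?thesis using antisym[of i j] key[OF ij int(2)] key[OF ij(2,1) int(1)] ij U by auto
qed

definition proportional_on :: "nat set \<Rightarrow> 'k::field \<Rightarrow> (nat \<Rightarrow> 'k) \<Rightarrow> (nat \<Rightarrow> 'k) \<Rightarrow> bool" where
  "proportional_on B c a b \<longleftrightarrow> (\<forall>i\<in>B. a i = c * b i)"

text \<open>If two initial forms had different ratios, some direction on the ray between theirs would have
  an initial form containing terms of both ratios.\<close>

lemma ratio_connected:
  fixes a b :: "nat \<Rightarrow> 'k::field"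
  assumes fin: "finite U" "U \<noteq> {}" and v: "v \<in> functionals" and w: "w \<in> functionals"
    and ratios: "\<And>u. u \<in> functionals \<Longrightarrow> tops u U \<noteq> U \<Longrightarrow> \<exists>c. proportional_on (tops u U) c a b"
    and nz: "\<And>u i. u \<in> functionals \<Longrightarrow> tops u U \<noteq> U \<Longrightarrow> i \<in> tops u U \<Longrightarrow> b i \<noteq> 0"
    and ray: "\<And>t. 0 \<le> t \<Longrightarrow> tops (\<lambda>l. v l + t * w l) U \<noteq> U" "tops w U \<noteq> U"
    and cv: "proportional_on (tops v U) c a b"
  shows "proportional_on (tops w U) c a b"
proof (rule ccontr)
  assume "\<not> ?thesis"
  then obtain y where y: "y \<in> tops w U" "a y \<noteq> c * b y" by (auto simp: proportional_on_def)
  define C1 where "C1 = {l \<in> U. a l = c * b l}"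
  define C2 where "C2 = {l \<in> U. a l \<noteq> c * b l}"
  have U: "U = C1 \<union> C2" "finite C1" "finite C2" using fin by (auto simp: C1_def C2_def)
  obtain d where d: "proportional_on (tops w U) d a b" using ratios[OF w ray(2)] by blast
  obtain x where x: "x \<in> tops v U" using tops_nonempty[OF fin] by blast
  have "x \<in> C1" using x cv by (auto simp: C1_def proportional_on_def tops_def)
  moreover have "v k \<le> v x" if "k \<in> C2" for k using x that by (auto simp: tops_def C2_def)
  moreover have "y \<in> C2" using y by (auto simp: C2_def tops_def)
  \<comment> \<open>A term of ratio \<open>c\<close> that is top for \<open>w\<close> would force
    \<open>d = c\<close>, contradicting the choice of \<open>y\<close>.\<close>
  moreover have "w l < w y" if l: "l \<in> C1" for l
  proof (rule ccontr)
    assume "\<not> w l < w y"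
    then have "l \<in> tops w U" using y(1) l by (fastforce simp: tops_def C1_def)
    then have "c * b l = d * b l" "b l \<noteq> 0" using l d nz[OF w ray(2)]
      by (auto simp: C1_def proportional_on_def)
    then have "c = d" by simp
    then show False using y d by (simp add: proportional_on_def)
  qed
  ultimately have "\<exists>t\<ge>0. \<exists>l\<in>C1. \<exists>k\<in>C2. v l + t * w l = v k + t * w k \<and>
    (\<forall>j\<in>C1 \<union> C2. v j + t * w j \<le> v l + t * w l)" by (rule maximum_in_both[OF U(2,3)])
  then obtain t l k where t: "0 \<le> t" "l \<in> C1" "k \<in> C2" "v l + t * w l = v k + t * w k"
    "\<forall>j\<in>C1 \<union> C2. v j + t * w j \<le> v l + t * w l" by blast
  define u where "u = (\<lambda>l. v l + t * w l)"
  have u: "u \<in> functionals" unfolding u_def by (intro functionals_add functionals_scale v w)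
  have pr: "tops u U \<noteq> U" using ray(1)[OF t(1)] by (simp add: u_def)
  have lk: "l \<in> tops u U" "k \<in> tops u U" using t by (auto simp: tops_def u_def U(1))
  obtain e where e: "proportional_on (tops u U) e a b" using ratios[OF u pr] by blast
  have "c * b l = e * b l" using e lk(1) t(2) by (auto simp: C1_def proportional_on_def)
  then have "c = e" using nz[OF u pr lk(1)] by simp
  then show False using e lk(2) t(3) by (auto simp: C2_def proportional_on_def)
qed

text \<open>By induction each proper face has its own ratio. \<open>ratio_connected\<close>
  transports ratios along a ray of directions none of which is constant on \<open>U\<close>;
  starting from \<open>v\<close> towards \<open>w\<close> or its negative, this can fail only if
  \<open>v\<close> is an affine function of \<open>w\<close> on \<open>U\<close>. So
  \<open>w\<close> and its negative are compared through a third direction, and only for a segment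
  is there none.\<close>

lemma proportional:
  fixes a b :: "nat \<Rightarrow> 'k::alg_closed_field"
  assumes "zeros a = zeros b" "dominated (support a) (support b)" "dominated (support b) (support a)"
    and "support a \<noteq> {}"
  shows "\<exists>c. c \<noteq> 0 \<and> proportional_on {..<n} c a b"
  using assms
proof (induction "card (support a \<union> support b)" arbitrary: a b rule: less_induct)
  case less
  note zz = less.prems(1) and dom = less.prems(2,3) and nea = less.prems(4)
  define U where "U = support a \<union> support b"
  have U: "finite U" "U \<noteq> {}" "U \<subseteq> {..<n}" using nea by (auto simp: U_def support_def)
  have neb: "support b \<noteq> {}" using support_empty_iff[OF inj_chi zz] nea by simp
  have face: "\<exists>c. c \<noteq> 0 \<and> proportional_on (tops v U) c a b"
    if v: "v \<in> functionals" and pr: "tops v U \<noteq> U" for v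
  proof -
    define B where "B = tops v U"
    have B: "B \<subset> U" using pr tops_subset[of v U] by (auto simp: B_def)
    have ta: "tops v (support a) = support a \<inter> B"
      using tops_Un_dominated[OF dom(2) v] by (simp add: B_def U_def)
    have tb: "tops v (support b) = support b \<inter> B"
      using tops_Un_dominated[OF dom(1) v] by (simp add: B_def U_def Un_commute)
    have rest: "restr (support f \<inter> B) f = restr B f" for f :: "nat \<Rightarrow> 'k"
    proof
      fix i
      have "i \<in> B \<Longrightarrow> i < n" using B U(3) by auto
      then show "restr (support f \<inter> B) f i = restr B f i" by (auto simp: restr_def support_def)
    qed
    have "\<exists>c. c \<noteq> 0 \<and> proportional_on {..<n} c (restr B a) (restr B b)"
    proof (rule less.hyps)
      have "support (restr B a) \<union> support (restr B b) \<subset> U"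
        using B by (auto simp: support_restr)
      then show "card (support (restr B a) \<union> support (restr B b)) < card (support a \<union> support b)"
        using U(1) unfolding U_def by (intro psubset_card_mono)
      show "zeros (restr B a) = zeros (restr B b)"
        using zeros_initial_form[OF inj_chi v _ nea, of b] zeros_initial_form[OF inj_chi v _ neb, of a] zz
        unfolding ta tb rest by blast
      show "dominated (support (restr B a)) (support (restr B b))"
        unfolding support_restr by (rule dominated_tops[OF dom(1) v]) (auto simp: B_def U_def)
      show "dominated (support (restr B b)) (support (restr B a))"
        unfolding support_restr by (rule dominated_tops[OF dom(2) v]) (auto simp: B_def U_def Un_commute)
      show "support (restr B a) \<noteq> {}"
        using tops_nonempty[OF finite_support nea, of v] by (simp add: support_restr ta)
    qed
    then obtain c where c: "c \<noteq> 0" "\<And>i. i < n \<Longrightarrow> restr B a i = c * restr B b i"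
      unfolding proportional_on_def by blast
    have "a i = c * b i" if "i \<in> B" for i
    proof -
      have "i < n" using that B U(3) by auto
      then show ?thesis using c(2)[of i] that by (simp add: restr_def)
    qed
    then show ?thesis using c(1) unfolding proportional_on_def B_def by blast
  qed
  have face_nz: "a i \<noteq> 0 \<and> b i \<noteq> 0"
    if v: "v \<in> functionals" "tops v U \<noteq> U" "i \<in> tops v U" for v i
  proof -
    obtain c where "c \<noteq> 0" "a i = c * b i"
      using face[OF v(1,2)] v(3) by (auto simp: proportional_on_def)
    moreover have "a i \<noteq> 0 \<or> b i \<noteq> 0" using v(3) tops_subset[of v U] by (auto simp: U_def support_def)
    ultimately show ?thesis by auto
  qed
  show ?case
  proof (cases "\<exists>i. U = {i}")
    case True
    then obtain i where "U = {i}" by blast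
    then have "support a \<subseteq> {i}" "support b \<subseteq> {i}" by (auto simp: U_def)
    then have i: "support a = {i}" "support b = {i}" using nea neb by (simp_all add: subset_singleton_iff)
    have "a j = a i / b i * b j" if "j < n" for j
    proof (cases "j = i")
      case False
      then have "j \<notin> support a" "j \<notin> support b" using i by auto
      then show ?thesis using that by (simp add: support_def)
    qed (use i in \<open>auto simp: support_def\<close>)
    moreover have "a i / b i \<noteq> 0" using i by (auto simp: support_def)
    ultimately show ?thesis by (intro exI[of _ "a i / b i"]) (auto simp: proportional_on_def)
  next
    case False
    have two: "\<exists>j\<in>U. j \<noteq> i" for i
    proof (rule ccontr)
      assume "\<not> (\<exists>j\<in>U. j \<noteq> i)"
      then have "U \<subseteq> {i}" by auto
      then have "U = {i}" using U(2) by (simp add: subset_singleton_iff)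
      then show False using False by simp
    qed
    \<comment> \<open>A separating direction is constant on no set with two elements, so it and its
      negative cut out proper faces, namely single vertices.\<close>
    obtain w0 where w0: "inj_on (pairing w0) {..<n}" using separating_direction[OF inj_chi] by blast
    define w where "w i = (of_int (pairing w0 i) :: rat)" for i
    have w: "w \<in> functionals" unfolding w_def by (rule pairing_functional)
    have w': "(\<lambda>i. - w i) \<in> functionals" by (rule functionals_uminus[OF w])
    have w_inj: "i = j" if "i \<in> U" "j \<in> U" "w i = w j" for i j
      using that w0 U(3) by (auto simp: w_def inj_on_def)
    have proper: "tops u U \<noteq> U" if ui: "\<And>i j. i \<in> U \<Longrightarrow> j \<in> U \<Longrightarrow> u i = u j \<Longrightarrow> i = j" for u
    proof
      assume e: "tops u U = U"
      obtain i where i: "i \<in> U" using U(2) by blast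
      obtain j where j: "j \<in> U" "j \<noteq> i" using two by blast
      have "i \<in> tops u U" "j \<in> tops u U" using i j(1) e by simp_all
      then have "u i = u j" using i j(1) by (force simp: tops_def)
      then show False using ui[OF i j(1)] j(2) by simp
    qed
    have pw: "tops w U \<noteq> U" by (rule proper) (rule w_inj)
    have pw': "tops (\<lambda>i. - w i) U \<noteq> U" by (rule proper) (use w_inj in simp)
    obtain c0 where c0: "c0 \<noteq> 0" "proportional_on (tops w U) c0 a b" using face[OF w pw] by blast
    define prop_w where "prop_w v \<longleftrightarrow> (\<exists>al be. \<forall>l\<in>U. v l = al + be * w l)" for v
    have conn: "proportional_on (tops u U) c a b"
      if v: "v \<in> functionals" "\<not> prop_w v" "proportional_on (tops v U) c a b" and u: "u = w \<or> u = (\<lambda>i. - w i)" for u v c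
    proof (rule ratio_connected[OF U(1,2) v(1) _ _ _ _ _ v(3)])
      show "u \<in> functionals" "tops u U \<noteq> U" using u w w' pw pw' by auto
      show "\<exists>c. proportional_on (tops u U) c a b" if "u \<in> functionals" "tops u U \<noteq> U" for u
        using face[OF that] by blast
      show "b i \<noteq> 0" if "u \<in> functionals" "tops u U \<noteq> U" "i \<in> tops u U" for u i
        using face_nz[OF that] by blast
      show "tops (\<lambda>l. v l + t * u l) U \<noteq> U" if "0 \<le> t" for t
      proof
        assume e: "tops (\<lambda>l. v l + t * u l) U = U"
        obtain i where i: "i \<in> U" using U(2) by blast
        have eq: "v l + t * u l = v i + t * u i" if "l \<in> U" for l
        proof -
          have "l \<in> tops (\<lambda>l. v l + t * u l) U" "i \<in> tops (\<lambda>l. v l + t * u l) U" using e i that by simp_all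
          then show ?thesis using i that by (force simp: tops_def)
        qed
        have "u = (\<lambda>i. 1 * w i) \<or> u = (\<lambda>i. (- 1) * w i)" using u by simp
        then obtain sg :: rat where sg: "u = (\<lambda>i. sg * w i)" by blast
        have "v l = (v i + t * u i) + (- (t * sg)) * w l" if "l \<in> U" for l
          using eq[OF that] by (simp add: sg algebra_simps)
        then show False using v(2) unfolding prop_w_def by blast
      qed
    qed
    have minus_w: "proportional_on (tops (\<lambda>i. - w i) U) c0 a b"
    proof (cases "\<exists>v\<in>functionals. \<not> prop_w v")
      case True
      then obtain v where v: "v \<in> functionals" "\<not> prop_w v" by blast
      have "tops v U \<noteq> U"
      proof
        assume e: "tops v U = U"
        obtain i where i: "i \<in> U" using U(2) by blast
        have "v l = v i + 0 * w l" if "l \<in> U" for l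
        proof -
          have "l \<in> tops v U" "i \<in> tops v U" using e i that by auto
          then show ?thesis by (force simp: tops_def)
        qed
        then show False using v(2) unfolding prop_w_def by blast
      qed
      then obtain c where c: "proportional_on (tops v U) c a b" using face[OF v(1)] by blast
      obtain i where i: "i \<in> tops w U" using tops_nonempty[OF U(1,2)] by blast
      have "proportional_on (tops w U) c a b" by (rule conn[OF v c]) simp
      then have "a i = c * b i" using i by (simp add: proportional_on_def)
      moreover have "a i = c0 * b i" using c0(2) i by (simp add: proportional_on_def)
      ultimately have "c * b i = c0 * b i" by (rule trans[OF sym])
      then have "c = c0" using face_nz[OF w pw i] by simp
      then show ?thesis using conn[OF v c, of "\<lambda>i. - w i"] by simp
    next
      case False
      obtain y where y: "y \<in> tops w U" using tops_nonempty[OF U(1,2)] by blast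
      obtain x where x: "x \<in> tops (\<lambda>i. - w i) U" using tops_nonempty[OF U(1,2)] by blast
      have xy: "x \<in> U" "y \<in> U" using x y by (auto simp: tops_def)
      have le: "w x \<le> w l" "w l \<le> w y" if "l \<in> U" for l using x y that by (auto simp: tops_def)
      have lt: "w x < w l" if "l \<in> U" "l \<noteq> x" for l
        using le(1)[OF that(1)] w_inj[OF xy(1) that(1)] that(2) by (auto simp: order_less_le)
      have gt: "w l < w y" if "l \<in> U" "l \<noteq> y" for l
        using le(2)[OF that(1)] w_inj[OF that(1) xy(2)] that(2) by (auto simp: order_less_le)
      have only_x: "tops (\<lambda>i. - w i) U = {x}"
        using lt x by (force simp: tops_def less_le_not_le)
      have nz: "a x \<noteq> 0" "b x \<noteq> 0" "a y \<noteq> 0" "b y \<noteq> 0"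
        using face_nz[OF w' pw' x] face_nz[OF w pw y] by auto
      have xny: "x \<noteq> y"
      proof
        assume "x = y"
        then have "w l = w x" if "l \<in> U" for l using le[OF that] by simp
        moreover obtain j where "j \<in> U" "j \<noteq> x" using two by blast
        ultimately show False using w_inj xy(1) by blast
      qed
      \<comment> \<open>On a segment, a functional maximal strictly between the ends is constant; by
        \<open>interior_unique\<close> there is at most one character in between, so at worst
        trinomials remain.\<close>
      have int: "tops v U = U" if m: "m \<in> U" "m \<noteq> x" "m \<noteq> y" and v: "v \<in> functionals" "m \<in> tops v U" for m v
      proof -
        obtain al be where ab: "\<forall>l\<in>U. v l = al + be * w l" using False v(1) unfolding prop_w_def by blast
        have "be * w y \<le> be * w m" "be * w x \<le> be * w m"
          using v(2) ab xy m(1) by (auto simp: tops_def)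
        then have "be * (w y - w m) \<le> 0" "be * (w m - w x) \<ge> 0" by (simp_all add: right_diff_distrib)
        moreover have "w y - w m > 0" "w m - w x > 0" using lt gt m by auto
        ultimately have "be = 0" by (simp add: mult_le_0_iff zero_le_mult_iff)
        then show ?thesis using ab by (auto simp: tops_def)
      qed
      have "a x * b y = b x * a y"
      proof (cases "\<exists>m\<in>U. m \<noteq> x \<and> m \<noteq> y")
        case True
        then obtain m where m: "m \<in> U" "m \<noteq> x" "m \<noteq> y" by blast
        have "l = m" if l: "l \<in> U" "l \<noteq> x" "l \<noteq> y" for l
          by (rule interior_unique[OF l(1) m(1) U(3) int[OF l] int[OF m]])
        then have "U \<subseteq> {x, m, y}" by blast
        then have supp: "support a \<subseteq> {x, m, y}" "support b \<subseteq> {x, m, y}" by (auto simp: U_def)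
        have pr: "pairing w0 x < pairing w0 m" "pairing w0 m < pairing w0 y"
          using lt[OF m(1,2)] gt[OF m(1,3)] by (simp_all add: w_def)
        show ?thesis
          by (rule ratio_trinomial[OF supp _ _ _ pr nz(1,3,2,4) zz]) (use xy m U(3) in auto)
      next
        case False
        then have "U \<subseteq> {x, y}" by blast
        then have "support a = {x, y}" "support b = {x, y}"
          using nz xy U(3) unfolding U_def support_def by auto
        then show ?thesis using xny zz by (rule ratio_binomial)
      qed
      moreover have "a y = c0 * b y" using c0(2) y by (simp add: proportional_on_def)
      ultimately have "a x * b y = (c0 * b x) * b y" by (simp add: mult_ac)
      then show ?thesis unfolding only_x using nz(4) by (simp add: proportional_on_def)
    qed
    have all: "proportional_on (tops v U) c0 a b" if v: "v \<in> functionals" "tops v U \<noteq> U" for v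
    proof (cases "prop_w v")
      case True
      then obtain al be where ab: "\<forall>l\<in>U. v l = al + be * w l" unfolding prop_w_def by blast
      consider "be = 0" | "be > 0" | "be < 0" by linarith
      then show ?thesis
      proof cases
        case 1
        then have "tops v U = U" using ab by (auto simp: tops_def)
        then show ?thesis using v(2) by simp
      next
        case 2
        then have "tops v U = tops w U" using ab by (auto simp: tops_def)
        then show ?thesis using c0(2) by simp
      next
        case 3
        then have "tops v U = tops (\<lambda>i. - w i) U" using ab by (auto simp: tops_def)
        then show ?thesis using minus_w by simp
      qed
    next
      case False
      obtain c where c: "proportional_on (tops v U) c a b" using face[OF v] by blast
      obtain i where i: "i \<in> tops w U" using tops_nonempty[OF U(1,2)] by blast
      have "proportional_on (tops w U) c a b" by (rule conn[OF v(1) False c]) simp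
      then have "a i = c * b i" using i by (simp add: proportional_on_def)
      moreover have "a i = c0 * b i" using c0(2) i by (simp add: proportional_on_def)
      ultimately have "c * b i = c0 * b i" by (rule trans[OF sym])
      then have "c = c0" using face_nz[OF w pw i] by simp
      then show ?thesis using c by simp
    qed
    define h where "h = (\<lambda>i. a i - c0 * b i)"
    have h_sub: "support h \<subseteq> U" by (auto simp: h_def U_def support_def)
    have h_int: "tops v U = U" if "m \<in> support h" "v \<in> functionals" "m \<in> tops v U" for m v
    proof (rule ccontr)
      assume "tops v U \<noteq> U"
      then have "a m = c0 * b m" using all[OF that(2)] that(3) by (simp add: proportional_on_def)
      then show False using that(1) by (simp add: h_def support_def)
    qed
    have "support h = {}"
    proof (rule ccontr)
      assume "support h \<noteq> {}"
      then obtain m where m: "m \<in> support h" by blast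
      have "l = m" if l: "l \<in> support h" for l
        using h_sub l m by (intro interior_unique[OF _ _ U(3) h_int[OF l] h_int[OF m]]) auto
      then have "support h = {m}" using m by blast
      \<comment> \<open>A single remaining term has no zeros, so \<open>a\<close> and
        \<open>b\<close> have none and are monomials; mutual domination makes these the same,
        although \<open>U\<close> is no singleton.\<close>
      then have "zeros h = {}" by (rule zeros_singleton)
      moreover have "zeros a \<subseteq> zeros h"
        using zz unfolding zeros_def h_def value_at_diff by auto
      ultimately have "zeros a = {}" "zeros b = {}" using zz by auto
      then obtain i j where i: "support a = {i}" and j: "support b = {j}"
        using support_singleton_if_no_zeros nea neb by metis
      have "u i = u j" if "u \<in> functionals" for u
        using dominatedD[OF dom(1) that, of i] dominatedD[OF dom(2) that, of j] i j by auto
      then have "i = j" using i j by (intro eq_if_functionals_eq) (auto simp: support_def)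
      then show False using False i j by (auto simp: U_def)
    qed
    then show ?thesis using c0(1)
      by (intro exI[of _ c0]) (auto simp: proportional_on_def support_def h_def)
  qed
qed

theorem proportional_if_same_on_faces:
  fixes a b :: "nat \<Rightarrow> 'k::alg_closed_field"
  assumes same: "same_on_faces a b" and ne: "support a \<noteq> {}"
  shows "\<exists>c. c \<noteq> 0 \<and> proportional_on {..<n} c a b"
proof (rule proportional[OF _ _ _ ne])
  have "tops (\<lambda>_. 0) {..<n} = {..<n}" by (auto simp: tops_def)
  then have "zeros (restr {..<n} a) = zeros (restr {..<n} b)"
    using same functionals_const[of 0] unfolding same_on_faces_def by metis
  moreover have "value_at (restr {..<n} f) = value_at f" for f :: "nat \<Rightarrow> 'k"
    by (auto simp: value_at_def restr_def)
  ultimately show "zeros a = zeros b" by (simp add: zeros_def)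
  have same': "same_on_faces b a" using same by (auto simp: same_on_faces_def)
  show "dominated (support a) (support b)"
    using support_dominated[OF same] unfolding dominated_def by blast
  show "dominated (support b) (support a)"
    using support_dominated[OF same'] unfolding dominated_def by blast
qed

end

section \<open>Hyperplane sections of the orbit closure\<close>

lemma proj_pt_eqD:
  assumes "proj_pt x = proj_pt y" "y \<in> carrier_vec n" "y \<noteq> 0\<^sub>v n"
  obtains c where "c \<noteq> 0" "y = c \<cdot>\<^sub>v x"
proof -
  have "y \<in> proj_pt y" unfolding proj_pt_def by (rule range_eqI[of _ _ 1]) simp
  then have "y \<in> proj_pt x" using assms(1) by simp
  then obtain c where c: "y = c \<cdot>\<^sub>v x" by (auto simp: proj_pt_def)
  moreover have "c \<noteq> 0"
  proof
    assume "c = 0"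
    then have "y = 0\<^sub>v n" using c assms(2) by (intro eq_vecI) auto
    then show False using assms(3) by simp
  qed
  ultimately show ?thesis by (intro that[of c])
qed

definition hyperplane :: "nat \<Rightarrow> 'k::field vec \<Rightarrow> 'k vec set set" where
  "hyperplane n a = {proj_pt x | x. x \<in> carrier_vec n \<and> x \<noteq> 0\<^sub>v n \<and> a \<bullet> x = 0}"

lemma is_hyperplane_iff:
  "is_hyperplane n D \<longleftrightarrow> (\<exists>a\<in>carrier_vec n. a \<noteq> 0\<^sub>v n \<and> D = hyperplane n a)"
  by (simp add: is_hyperplane_def hyperplane_def)

lemma proj_pt_in_hyperplane:
  assumes "x \<in> carrier_vec n" "x \<noteq> 0\<^sub>v n" "a \<in> carrier_vec n"
  shows "proj_pt x \<in> hyperplane n a \<longleftrightarrow> a \<bullet> x = 0"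
proof
  assume "proj_pt x \<in> hyperplane n a"
  then obtain y where y: "proj_pt y = proj_pt x" "y \<in> carrier_vec n" "a \<bullet> y = 0"
    by (auto simp: hyperplane_def)
  obtain c where "x = c \<cdot>\<^sub>v y" using proj_pt_eqD[OF y(1) assms(1,2)] by blast
  then show "a \<bullet> x = 0" using y assms by simp
qed (use assms in \<open>auto simp: hyperplane_def\<close>)

lemma hyperplane_smult:
  assumes "c \<noteq> 0" "a \<in> carrier_vec n"
  shows "hyperplane n (c \<cdot>\<^sub>v a) = hyperplane n a"
proof -
  have "(c \<cdot>\<^sub>v a) \<bullet> x = 0 \<longleftrightarrow> a \<bullet> x = 0" if "x \<in> carrier_vec n" for x
    using assms that by simp
  then show ?thesis unfolding hyperplane_def by (intro Collect_cong) auto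
qed

lemma eval_mpoly_smult:
  assumes "homogeneous n d f" "x \<in> carrier_vec n"
  shows "eval_mpoly f (c \<cdot>\<^sub>v x) = c ^ d * eval_mpoly f x"
  unfolding eval_mpoly_def sum_distrib_left
proof (intro sum.cong refl)
  fix m assume m: "m \<in> Poly_Mapping.keys f"
  then have k: "Poly_Mapping.keys m \<subseteq> {..<n}" "(\<Sum>i\<in>Poly_Mapping.keys m. Poly_Mapping.lookup m i) = d"
    using assms(1) by (auto simp: homogeneous_def)
  have "(\<Prod>i\<in>Poly_Mapping.keys m. ((c \<cdot>\<^sub>v x) $ i) ^ Poly_Mapping.lookup m i)
      = (\<Prod>i\<in>Poly_Mapping.keys m. c ^ Poly_Mapping.lookup m i * (x $ i) ^ Poly_Mapping.lookup m i)"
    using k(1) assms(2) by (intro prod.cong) (auto simp: power_mult_distrib)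
  also have "\<dots> = c ^ d * (\<Prod>i\<in>Poly_Mapping.keys m. (x $ i) ^ Poly_Mapping.lookup m i)"
    by (simp add: prod.distrib k(2) flip: power_sum)
  finally show "Poly_Mapping.lookup f m * (\<Prod>i\<in>Poly_Mapping.keys m. ((c \<cdot>\<^sub>v x) $ i) ^ Poly_Mapping.lookup m i)
      = c ^ d * (Poly_Mapping.lookup f m * (\<Prod>i\<in>Poly_Mapping.keys m. (x $ i) ^ Poly_Mapping.lookup m i))"
    by simp
qed

section \<open>Binomial equations of the orbit closure\<close>

definition binomial_poly :: "nat \<Rightarrow> nat \<Rightarrow> nat \<Rightarrow> (nat \<Rightarrow> nat) \<Rightarrow> 'k::field mpoly" where
  "binomial_poly n i N c = Poly_Mapping.single (Poly_Mapping.single i N) 1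
     - Poly_Mapping.single (\<Sum>l<n. Poly_Mapping.single l (c l)) 1"

lemma lookup_sum_single: "Poly_Mapping.lookup (\<Sum>l<(n::nat). Poly_Mapping.single l (c l)) k = (if k < n then c k else (0::nat))"
  by (simp add: lookup_sum lookup_single when_def)

lemma keys_sum_single: "Poly_Mapping.keys (\<Sum>l<(n::nat). Poly_Mapping.single l (c l)) = {l. l < n \<and> c l \<noteq> (0::nat)}"
  by (auto simp: in_keys_iff lookup_sum_single split: if_splits)

text \<open>Since \<open>c j > 0\<close> with \<open>j \<noteq> i\<close>, the two monomials are
  distinct and do not cancel.\<close>

lemma binomial_poly:
  fixes x :: "'k::field vec"
  assumes "i < n" "j < n" "i \<noteq> j" "c j > 0" "N > 0" "sum c {..<n} = N"
  shows "homogeneous n N (binomial_poly n i N c :: 'k mpoly)"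
    and "eval_mpoly (binomial_poly n i N c) x = (x $ i) ^ N - (\<Prod>l<n. (x $ l) ^ c l)"
proof -
  define m1 where "m1 = Poly_Mapping.single i N"
  define m2 where "m2 = (\<Sum>l<n. Poly_Mapping.single l (c l))"
  define f where "f = (binomial_poly n i N c :: 'k mpoly)"
  have "Poly_Mapping.lookup m1 j \<noteq> Poly_Mapping.lookup m2 j"
    using assms by (simp add: m1_def m2_def lookup_sum_single lookup_single when_def)
  then have ne: "m1 \<noteq> m2" by auto
  have look: "Poly_Mapping.lookup f m = (if m = m1 then 1 else if m = m2 then - 1 else 0)" for m
    using ne by (auto simp: f_def binomial_poly_def m1_def[symmetric] m2_def[symmetric]
        lookup_minus lookup_single when_def)
  have keys: "Poly_Mapping.keys f = {m1, m2}"
    using look by (auto simp: in_keys_iff split: if_splits)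
  have k1: "Poly_Mapping.keys m1 = {i}" using assms by (simp add: m1_def)
  have k2: "Poly_Mapping.keys m2 = {l. l < n \<and> c l \<noteq> 0}" by (simp add: m2_def keys_sum_single)
  have l1: "Poly_Mapping.lookup m1 i = N" by (simp add: m1_def)
  have l2: "Poly_Mapping.lookup m2 l = c l" if "l < n" for l using that by (simp add: m2_def lookup_sum_single)
  have s2: "(\<Sum>l\<in>Poly_Mapping.keys m2. Poly_Mapping.lookup m2 l) = N"
  proof -
    have "(\<Sum>l\<in>Poly_Mapping.keys m2. Poly_Mapping.lookup m2 l) = (\<Sum>l\<in>Poly_Mapping.keys m2. c l)"
      using l2 k2 by (intro sum.cong) auto
    also have "\<dots> = sum c {..<n}" unfolding k2 by (intro sum.mono_neutral_left) auto
    finally show ?thesis using assms(6) by simp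
  qed
  show "homogeneous n N (binomial_poly n i N c :: 'k mpoly)"
    unfolding homogeneous_def f_def[symmetric] keys using assms(1) k1 k2 l1 s2 by auto
  have "(\<Prod>l\<in>Poly_Mapping.keys m2. (x $ l) ^ Poly_Mapping.lookup m2 l) = (\<Prod>l\<in>Poly_Mapping.keys m2. (x $ l) ^ c l)"
    using l2 k2 by (intro prod.cong) auto
  also have "\<dots> = (\<Prod>l<n. (x $ l) ^ c l)" unfolding k2 by (intro prod.mono_neutral_left) auto
  finally show "eval_mpoly (binomial_poly n i N c) x = (x $ i) ^ N - (\<Prod>l<n. (x $ l) ^ c l)"
    unfolding eval_mpoly_def f_def[symmetric] keys using ne look k1 l1 by simp
qed

context weights
begin

definition orbit_pt :: "'k::field vec \<Rightarrow> 'k vec" where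
  "orbit_pt t = vec n (\<lambda>i. character (chi i) t)"

lemma orbit_eq:
  "{torus_act n chi t (proj_pt (vec n (\<lambda>_. 1))) | t. t \<in> torus r} = {proj_pt (orbit_pt t) | t. t \<in> torus r}"
proof -
  have "torus_act n chi t (proj_pt (vec n (\<lambda>_. 1))) = proj_pt (orbit_pt t)" for t :: "'a vec"
  proof -
    have "vec n (\<lambda>i. character (chi i) t * vec n (\<lambda>_. 1) $ i) = orbit_pt t"
      by (intro eq_vecI) (auto simp: orbit_pt_def)
    then show ?thesis using torus_act_proj_pt[of "vec n (\<lambda>_. 1)" n chi t] by simp
  qed
  then show ?thesis by simp
qed

lemma vec_nonzero: "i < n \<Longrightarrow> f i \<noteq> 0 \<Longrightarrow> vec n f \<noteq> 0\<^sub>v n"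
  by (metis index_vec index_zero_vec(1))

lemma orbit_pt_carrier: "orbit_pt t \<in> carrier_vec n"
  by (simp add: orbit_pt_def)

lemma orbit_pt_nonzero:
  assumes "n \<ge> 1" "t \<in> torus r"
  shows "orbit_pt t \<noteq> 0\<^sub>v n"
  unfolding orbit_pt_def using assms character_nonzero[of 0 t] by (intro vec_nonzero[of 0]) auto

text \<open>The relation between characters makes the binomial vanish on the orbit, and its zero
  locus is closed.\<close>

lemma binomial_vanishes_on_orbit_closure:
  fixes p :: "'k::field vec set"
  assumes n: "n \<ge> 1" and ij: "i < n" "j < n" "i \<noteq> j" "c j > 0" "N > 0" "sum c {..<n} = N"
    and rel: "\<And>k. k < r \<Longrightarrow> of_nat N * chi i $ k = (\<Sum>l<n. of_nat (c l) * chi l $ k)"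
    and p: "p \<in> orbit_closure r n chi"
  obtains x where "p = proj_pt x" "x \<in> carrier_vec n" "x \<noteq> 0\<^sub>v n" "(x $ i) ^ N = (\<Prod>l<n. (x $ l) ^ c l)"
proof -
  define Z where "Z = {proj_pt x | x :: 'k vec. x \<in> carrier_vec n \<and> x \<noteq> 0\<^sub>v n \<and>
    (\<forall>f\<in>{binomial_poly n i N c}. eval_mpoly f x = 0)}"
  have "zariski_closed n Z"
    unfolding zariski_closed_def Z_def
    by (intro exI[of _ "{binomial_poly n i N c}"]) (use binomial_poly(1)[OF ij] in auto)
  moreover have "{proj_pt (orbit_pt t) | t. t \<in> torus r} \<subseteq> Z"
  proof safe
    fix t :: "'k vec" assume t: "t \<in> torus r"
    have tj: "t $ j \<noteq> 0" if "j < r" for j using t that by (simp add: torus_def)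
    have "character (chi i) t ^ N = (\<Prod>k<r. (t $ k) powi (of_nat N * chi i $ k))"
      using chi[OF ij(1)] by (simp add: character_def prod_power_distrib power_int_power' mult.commute)
    also have "\<dots> = (\<Prod>k<r. \<Prod>l<n. (t $ k) powi (of_nat (c l) * chi l $ k))"
      using tj by (intro prod.cong refl) (simp add: rel prod_powi)
    also have "\<dots> = (\<Prod>l<n. \<Prod>k<r. (t $ k) powi (of_nat (c l) * chi l $ k))" by (rule prod.swap)
    also have "\<dots> = (\<Prod>l<n. character (chi l) t ^ c l)"
      by (intro prod.cong refl)
        (simp add: character_def prod_power_distrib power_int_power' mult.commute carrier_vecD[OF chi])
    finally have "eval_mpoly (binomial_poly n i N c) (orbit_pt t) = 0"
      unfolding binomial_poly(2)[OF ij] using ij(1) by (simp add: orbit_pt_def)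
    then show "proj_pt (orbit_pt t) \<in> Z"
      using orbit_pt_carrier orbit_pt_nonzero[OF n t] by (auto simp: Z_def)
  qed
  ultimately have "orbit_closure r n chi \<subseteq> Z"
    unfolding orbit_closure_def zariski_closure_def orbit_eq by (intro hull_minimal)
  then obtain x where "p = proj_pt x" "x \<in> carrier_vec n" "x \<noteq> 0\<^sub>v n"
    "eval_mpoly (binomial_poly n i N c) x = 0" using p by (auto simp: Z_def)
  then show ?thesis using that[of x] by (simp add: binomial_poly(2)[OF ij])
qed

lemma unit_vec_scalar_prod: "i < n \<Longrightarrow> x \<in> carrier_vec n \<Longrightarrow> unit_vec n i \<bullet> x = (x $ i :: 'k::field)"
  by (rule scalar_prod_left_unit)

lemma coordinate_hyperplane_inclusion:
  assumes n: "n \<ge> 1" and face: "is_face r (weight_polytope n chi) F"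
    and ij: "i < n" "j < n" "i \<noteq> j"
      "rat_point (chi i) \<in> rat_rel_interior F" "rat_point (chi j) \<in> rat_rel_interior F"
  shows "hyperplane n (unit_vec n j) \<inter> orbit_closure r n chi
    \<subseteq> hyperplane n (unit_vec n i :: 'k::field vec)"
proof
  fix p :: "'k vec set" assume p: "p \<in> hyperplane n (unit_vec n j) \<inter> orbit_closure r n chi"
  obtain N :: nat and c :: "nat \<Rightarrow> nat" where Nc: "N > 0" "sum c {..<n} = N" "c j > 0"
    "\<And>k. k < r \<Longrightarrow> of_nat N * chi i $ k = (\<Sum>l<n. of_nat (c l) * chi l $ k)"
    by (rule relation_if_rel_interior[OF face ij]) (rule that; assumption)
  obtain x where x: "p = proj_pt x" "x \<in> carrier_vec n" "x \<noteq> 0\<^sub>v n" "(x $ i) ^ N = (\<Prod>l<n. (x $ l) ^ c l)"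
    by (rule binomial_vanishes_on_orbit_closure[OF n ij(1-3) Nc(3,1,2) Nc(4) IntD2[OF p]])
      (assumption | (rule that; assumption))+
  have "unit_vec n j \<bullet> x = 0" using p x proj_pt_in_hyperplane[OF x(2,3), of "unit_vec n j"] by simp
  then have "x $ j = 0" using x(2) ij(2) by (simp add: unit_vec_scalar_prod)
  then have "(\<Prod>l<n. (x $ l) ^ c l) = 0" using ij(2) Nc(3) by (intro prod_zero bexI[of _ j]) auto
  then have "(x $ i) ^ N = 0" using x(4) by (simp only:)
  then have "x $ i = 0" by simp
  then have "unit_vec n i \<bullet> x = 0" using x(2) ij(1) by (simp add: unit_vec_scalar_prod)
  then show "p \<in> hyperplane n (unit_vec n i)" using x proj_pt_in_hyperplane[OF x(2,3), of "unit_vec n i"] by simp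
qed

lemma card_le_1_if_weak_separation:
  assumes n: "n \<ge> 1" and ws: "weak_separation n (orbit_closure r n chi :: 'k::field vec set set)"
    and face: "is_face r (weight_polytope n chi) F"
  shows "card {i. i < n \<and> rat_point (chi i) \<in> rat_rel_interior F} \<le> 1"
proof (rule ccontr)
  assume "\<not> ?thesis"
  then have "card {i. i < n \<and> rat_point (chi i) \<in> rat_rel_interior F} \<ge> 2" by simp
  then obtain i j where ij: "i < n" "j < n" "i \<noteq> j"
    "rat_point (chi i) \<in> rat_rel_interior F" "rat_point (chi j) \<in> rat_rel_interior F"
    by (auto simp: card_le_Suc_iff numeral_2_eq_2)
  define D D' where "D = hyperplane n (unit_vec n i :: 'k vec)" and "D' = hyperplane n (unit_vec n j :: 'k vec)"
  have hyp: "is_hyperplane n D" "is_hyperplane n D'"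
    unfolding is_hyperplane_iff D_def D'_def using ij by (auto intro!: bexI[of _ "unit_vec n _"])
  have "proj_pt (unit_vec n j :: 'k vec) \<in> D"
    unfolding D_def using ij by (subst proj_pt_in_hyperplane) (auto simp: unit_vec_scalar_prod)
  moreover have "proj_pt (unit_vec n j :: 'k vec) \<notin> D'"
    unfolding D'_def using ij by (subst proj_pt_in_hyperplane) (auto simp: unit_vec_scalar_prod)
  ultimately have "D \<noteq> D'" by blast
  moreover have "D \<inter> orbit_closure r n chi = D' \<inter> orbit_closure r n chi"
    using coordinate_hyperplane_inclusion[OF n face ij, where 'k = 'k]
      coordinate_hyperplane_inclusion[OF n face ij(2,1) ij(3)[symmetric] ij(5,4), where 'k = 'k]
    unfolding D_def D'_def by blast
  ultimately show False using ws hyp unfolding weak_separation_def by blast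
qed

text \<open>The limit of the orbit of \<open>t\<close> in direction \<open>u\<close>: after dividing
  by the highest power, only the coordinates on the face survive.\<close>

definition limit_pt :: "(nat \<Rightarrow> rat) \<Rightarrow> 'k::field vec \<Rightarrow> 'k vec" where
  "limit_pt u t = vec n (\<lambda>i. if i \<in> tops u {..<n} then character (chi i) t else 0)"

lemma limit_pt_nonzero:
  assumes "n \<ge> 1" "t \<in> torus r"
  shows "limit_pt u t \<noteq> 0\<^sub>v n"
proof -
  have "{..<n} \<noteq> {}" using assms(1) by (auto simp: lessThan_empty_iff)
  then obtain i where i: "i \<in> tops u {..<n}" using tops_nonempty[of "{..<n}" u] by blast
  then have "i < n" by (auto simp: tops_def)
  then show ?thesis unfolding limit_pt_def using i assms(2) by (intro vec_nonzero[of i]) (auto simp: character_nonzero)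
qed

text \<open>Along a one-parameter subgroup a polynomial vanishing on the orbit becomes, after rescaling the
  coordinates, a polynomial in the parameter that vanishes off 0 and hence at 0.\<close>

lemma limit_pt_in_orbit_closure:
  fixes t :: "'k::alg_closed_field vec"
  assumes n: "n \<ge> 1" and u: "u \<in> functionals" and t: "t \<in> torus r"
  shows "proj_pt (limit_pt u t) \<in> orbit_closure r n chi"
  unfolding orbit_closure_def zariski_closure_def orbit_eq hull_def
proof (intro InterI, safe)
  fix Z :: "'k vec set set" assume Z: "zariski_closed n Z" and sub: "{proj_pt (orbit_pt t) | t. t \<in> torus r} \<subseteq> Z"
  obtain S where S: "\<forall>f\<in>S. \<exists>d. homogeneous n d f"
    "Z = {proj_pt x | x. x \<in> carrier_vec n \<and> x \<noteq> 0\<^sub>v n \<and> (\<forall>f\<in>S. eval_mpoly f x = 0)}"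
    using Z unfolding zariski_closed_def by blast
  obtain u' c and D :: rat where u': "D > 0" "\<And>i. of_int (pairing u' i) = D * (u i - c)"
    by (rule integral_direction[OF u]) (rule that; assumption)
  define M where "M = Max (pairing u' ` {..<n})"
  have M: "pairing u' i \<le> M" if "i < n" for i unfolding M_def using that by simp
  have "M \<in> pairing u' ` {..<n}" unfolding M_def using n by (intro Max_in) (auto simp: lessThan_empty_iff)
  then obtain i0 where i0: "i0 < n" "M = pairing u' i0" by auto
  have top: "i \<in> tops u {..<n} \<longleftrightarrow> pairing u' i = M" if "i < n" for i
    using that M i0 tops_integral_direction[OF u'] unfolding tops_def by (auto intro: antisym)
  \<comment> \<open>Rescaling all coordinates by \<open>e powi M\<close> keeps the projective point
    and makes the exponents of the parameter natural numbers, zero exactly on the face.\<close>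
  define d where "d i = nat (M - pairing u' i)" for i
  define y where "y e = vec n (\<lambda>i. character (chi i) t * e ^ d i)" for e
  have y0: "y 0 = limit_pt u t"
  proof -
    have "i \<in> tops u {..<n} \<longleftrightarrow> d i = 0" if "i < n" for i
      using top[OF that] M[OF that] by (auto simp: d_def)
    then show ?thesis
      unfolding y_def limit_pt_def by (intro eq_vecI) (auto simp: power_0_left)
  qed
  have ye: "y e = (e powi M) \<cdot>\<^sub>v orbit_pt (shift t e (\<lambda>j. - u' j))" if e: "e \<noteq> 0" for e
  proof (intro eq_vecI)
    fix i assume "i < dim_vec ((e powi M) \<cdot>\<^sub>v orbit_pt (shift t e (\<lambda>j. - u' j)))"
    then have i: "i < n" by (simp add: orbit_pt_def)
    have "e ^ d i = e powi (M + pairing (\<lambda>j. - u' j) i)"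
      using M[OF i] by (simp add: d_def power_int_nonneg_exp pairing_def sum_negf)
    then show "y e $ i = ((e powi M) \<cdot>\<^sub>v orbit_pt (shift t e (\<lambda>j. - u' j))) $ i"
      using i e by (simp add: y_def orbit_pt_def character_shift power_int_add mult_ac)
  qed (simp add: y_def orbit_pt_def)
  have "eval_mpoly f (y 0) = 0" if f: "f \<in> S" for f
  proof -
    obtain k where k: "homogeneous n k f" using S(1) f by blast
    have off: "eval_mpoly f (y e) = 0" if e: "e \<noteq> 0" for e
    proof -
      define z where "z = orbit_pt (shift t e (\<lambda>j. - u' j))"
      have zt: "shift t e (\<lambda>j. - u' j) \<in> torus r" by (rule shift_torus[OF t e])
      then have "proj_pt z \<in> Z" using sub unfolding z_def by blast
      then obtain x where x: "proj_pt x = proj_pt z" "x \<in> carrier_vec n" "eval_mpoly f x = 0"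
        using f unfolding S(2) by force
      obtain b where "z = b \<cdot>\<^sub>v x"
        using proj_pt_eqD[OF x(1) orbit_pt_carrier[of "shift t e (\<lambda>j. - u' j)", folded z_def]]
          orbit_pt_nonzero[OF n zt] unfolding z_def by blast
      then have "eval_mpoly f z = 0" using eval_mpoly_smult[OF k x(2)] x(3) by simp
      then show ?thesis unfolding ye[OF e] z_def[symmetric]
        using eval_mpoly_smult[OF k, of z] by (simp add: z_def orbit_pt_carrier)
    qed
    define P where "P = (\<Sum>m\<in>Poly_Mapping.keys f. [:Poly_Mapping.lookup f m:] *
      (\<Prod>i\<in>Poly_Mapping.keys m. (monom (character (chi i) t) (d i)) ^ Poly_Mapping.lookup m i))"
    have P: "poly P e = eval_mpoly f (y e)" for e
    proof -
      have "poly P e = (\<Sum>m\<in>Poly_Mapping.keys f. Poly_Mapping.lookup f m *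
        (\<Prod>i\<in>Poly_Mapping.keys m. (character (chi i) t * e ^ d i) ^ Poly_Mapping.lookup m i))"
        by (simp add: P_def poly_sum poly_prod poly_monom poly_power)
      also have "\<dots> = eval_mpoly f (y e)"
        unfolding eval_mpoly_def
      proof (intro sum.cong refl arg_cong2[where f = "(*)"] prod.cong)
        fix m i assume "m \<in> Poly_Mapping.keys f" "i \<in> Poly_Mapping.keys m"
        then have "i < n" using k by (auto simp: homogeneous_def)
        then show "(character (chi i) t * e ^ d i) ^ Poly_Mapping.lookup m i = (y e $ i) ^ Poly_Mapping.lookup m i"
          by (simp add: y_def)
      qed
      finally show ?thesis .
    qed
    have "P = 0" by (rule poly_eq_0_if_zero_off_0[of "{0}"]) (use off P in auto)
    then show ?thesis using P[of 0] by simp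
  qed
  then show "proj_pt (limit_pt u t) \<in> Z"
    unfolding S(2) y0 using limit_pt_nonzero[OF n t, of u] by (auto simp: limit_pt_def)
qed

end

section \<open>From equal sections to equal hyperplanes\<close>

context separated_weights
begin

lemma weak_separation_orbit_closure:
  assumes n: "n \<ge> 1"
  shows "weak_separation n (orbit_closure r n chi :: 'k::alg_closed_field vec set set)"
  unfolding weak_separation_def
proof (intro allI impI notI)
  fix D D' :: "'k vec set set"
  assume hyp: "is_hyperplane n D" "is_hyperplane n D'" and ne: "D \<noteq> D'"
    and eq: "D \<inter> orbit_closure r n chi = D' \<inter> orbit_closure r n chi"
  obtain a a' where a: "a \<in> carrier_vec n" "a \<noteq> 0\<^sub>v n" "D = hyperplane n a"
    and a': "a' \<in> carrier_vec n" "a' \<noteq> 0\<^sub>v n" "D' = hyperplane n a'"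
    using hyp unfolding is_hyperplane_iff by blast
  \<comment> \<open>A linear form evaluated at a limit point is the restriction of its Laurent
    polynomial to the face.\<close>
  have val: "value_at (restr (tops u {..<n}) (($) b)) t = b \<bullet> limit_pt u t" for b t :: "'k vec" and u
    by (auto simp: value_at_def restr_def limit_pt_def scalar_prod_def atLeast0LessThan intro!: sum.cong)
  have "same_on_faces (($) a) (($) a')"
    unfolding same_on_faces_def
  proof
    fix u assume u: "u \<in> functionals"
    have "a \<bullet> limit_pt u t = 0 \<longleftrightarrow> a' \<bullet> limit_pt u t = 0" if t: "t \<in> torus r" for t
    proof -
      have x: "limit_pt u t \<in> carrier_vec n" "limit_pt u t \<noteq> 0\<^sub>v n"
        using limit_pt_nonzero[OF n t] by (auto simp: limit_pt_def)
      have "proj_pt (limit_pt u t) \<in> D \<longleftrightarrow> proj_pt (limit_pt u t) \<in> D'"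
        using eq limit_pt_in_orbit_closure[OF n u t] by blast
      then show ?thesis
        unfolding a(3) a'(3) proj_pt_in_hyperplane[OF x a(1)] proj_pt_in_hyperplane[OF x a'(1)] .
    qed
    then show "zeros (restr (tops u {..<n}) (($) a)) = zeros (restr (tops u {..<n}) (($) a'))"
      unfolding zeros_def val by blast
  qed
  moreover have "support (($) a) \<noteq> {}"
  proof
    assume s: "support (($) a) = {}"
    have "a = 0\<^sub>v n" using a(1) s by (intro eq_vecI) (auto simp: support_def)
    then show False using a(2) by simp
  qed
  ultimately obtain c where c: "c \<noteq> 0" "proportional_on {..<n} c (($) a) (($) a')"
    using proportional_if_same_on_faces by blast
  have "a = c \<cdot>\<^sub>v a'" using a(1) a'(1) c(2) by (intro eq_vecI) (auto simp: proportional_on_def)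
  then have "D = D'" using hyperplane_smult[OF c(1) a'(1)] a(3) a'(3) by simp
  then show False using ne by simp
qed

end

theorem theorem4:
  fixes r n :: nat
    and chi :: "nat \<Rightarrow> int vec"
    and X :: "'k::alg_closed_field vec set set"
  assumes "n \<ge> 1"
    and "\<And>i. i < n \<Longrightarrow> chi i \<in> carrier_vec r"
    and "X = orbit_closure r n chi"
  shows "(weak_separation n X \<longleftrightarrow>
            (\<forall>F. is_face r (weight_polytope n chi) F \<longrightarrow>
               card {i. i < n \<and> rat_point (chi i) \<in> rat_rel_interior F} \<le> 1)) \<and>
         ((\<forall>F. is_face r (weight_polytope n chi) F \<longrightarrow>
               card {i. i < n \<and> rat_point (chi i) \<in> rat_rel_interior F} \<le> 1) \<longrightarrow>
            inj_on chi {..<n})"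
proof -
  interpret weights r n chi using assms(2) by unfold_locales
  have sep: "separated_weights r n chi"
    if one: "\<forall>F. is_face r (weight_polytope n chi) F \<longrightarrow>
      card {i. i < n \<and> rat_point (chi i) \<in> rat_rel_interior F} \<le> 1"
  proof
    show "i = j" if "i < n" "j < n" "in_minimal_face i j" "in_minimal_face j i" for i j
      using one by (intro in_minimal_face_antisym[OF _ that]) simp
  qed
  show ?thesis
    unfolding assms(3)
  proof (intro conjI iffI impI allI)
    show "card {i. i < n \<and> rat_point (chi i) \<in> rat_rel_interior F} \<le> 1"
      if "weak_separation n (orbit_closure r n chi :: 'k vec set set)"
        "is_face r (weight_polytope n chi) F" for F
      by (rule card_le_1_if_weak_separation[OF assms(1) that])
  qed (use sep separated_weights.weak_separation_orbit_closure[OF _ assms(1)]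
      separated_weights.inj_chi in simp_all)
qed

end
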